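(* Let $\lambda$ be a complex number with $\lambda\neq1$ and $\Re(\lambda)>0$. Let $Z$ be a complex-valued random variable satisfying $Z\overset{\mathcal L}{=}e^{-\lambda T}(Z^{(1)}+\dots+Z^{(m)})$, where $Z^{(1)},\dots,Z^{(m)}$ are independent copies of $Z$ independent of $T$, with $\mathbb E|Z|<\infty$ and $\mathbb EZ\ne0$. Then: (i) the support of $Z$ is the whole complex plane $\mathbb C$; (ii) as $|t|\to\infty$, $\mathbb E e^{i\langle t,Z\rangle}=O(|t|^{-a})$ for every $a\in\,]0,1/\Re(\lambda)[$; (iii) the distribution of $Z$ has a density with respect to Lebesgue measure on $\mathbb C$.
   Context: $m\ge2$ is an integer. $T=\tau_{(1)}+\dots+\tau_{(m-1)}$ where the $\tau_{(j)}$ are independent and $\tau_{(j)}$ is exponential with parameter $j$. For $x,y\in\mathbb C$, $\langle x,y\rangle=\Re(\overline xy)$. *)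

theory Defs
  imports "HOL-Probability.Probability" "HOL-Library.Landau_Symbols"
begin

definition cinner :: "complex \<Rightarrow> complex \<Rightarrow> real" where
  "cinner x y = Re (cnj x * y)"

definition T_law :: "nat \<Rightarrow> real measure" where
  "T_law m = distr (PiM {1..m-1} (\<lambda>j. density lborel (\<lambda>x. ennreal (exponential_density (real j) x))))
                   borel (\<lambda>x. \<Sum>j\<in>{1..m-1}. x j)"

definition fixpoint_rhs_law :: "complex \<Rightarrow> nat \<Rightarrow> complex measure \<Rightarrow> complex measure" where
  "fixpoint_rhs_law lam m \<mu> =
     distr (T_law m \<Otimes>\<^sub>M PiM {1..m} (\<lambda>_. \<mu>)) borel
       (\<lambda>(t, z). exp (- (lam * complex_of_real t)) * (\<Sum>j\<in>{1..m}. z j))"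

definition support_of :: "complex measure \<Rightarrow> complex set" where
  "support_of \<mu> = {z. \<forall>e>0. emeasure \<mu> (ball z e) > 0}"

end

(* The mean equation m E[exp(-lam T)] = 1 forces lam to be non-real: E[exp(-s T)] is the product of
   j/(j+s) over j < m, which for real s > 0 equals 1/m only at s = 1.

   Density: since T is continuous, Z has no atom outside 0, and P(Z = 0) = P(Z = 0)^m gives
   P(Z = 0) = 0. Unfolding the equation twice, Z = exp(-lam T) (exp(-lam T') S + W) with S, W nonzero
   a.s. and T, T' absolutely continuous; given S and W this is a smooth map of (T, T') whose
   Jacobian vanishes only on countably many lines, so preimages of null sets are null.


   Decay: the Riemann-Lebesgue lemma yields phi -> 0 for the characteristic function phi. Hence
   |phi|^m <= eps |phi| + (R/|.|)^a, and iterating phi(t) = E[phi(exp(-conj(lam) T) t)^m] gives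
   |phi(t)| <= 2C |t|^(-a) + 2^(-n) for all n, where E[exp(a Re(lam) T)] is finite as a Re(lam) < 1.

   Support: it is a closed additive semigroup containing 0, stable under multiplication by
   exp(-lam t), t > 0. A spiral through one nonzero point meets every ray at arbitrarily small
   radii, and integer multiples of these points are dense in the ray. *)

theory Submission
  imports Defs
begin

section \<open>The Riemann--Lebesgue lemma in the plane\<close>

lemma borel_measurable_cinner [measurable (raw)]:
  assumes [measurable]: "f \<in> borel_measurable M" "g \<in> borel_measurable M"
  shows "(\<lambda>x. cinner (f x) (g x)) \<in> borel_measurable M"
proof -
  have "(\<lambda>z. cnj z) \<in> borel_measurable borel"
    by (intro borel_measurable_continuous_onI continuous_intros)
  then have [measurable]: "(\<lambda>x. cnj (f x)) \<in> borel_measurable M"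
    using assms(1) by (rule measurable_compose_rev)
  show ?thesis unfolding cinner_def by measurable
qed

lemma borel_measurable_cis [measurable (raw)]:
  assumes [measurable]: "f \<in> borel_measurable M"
  shows "(\<lambda>x. cis (f x)) \<in> borel_measurable M"
proof -
  have "cis \<in> borel_measurable borel"
    by (intro borel_measurable_continuous_onI continuous_intros)
  then show ?thesis using assms by (rule measurable_compose_rev)
qed

lemma cinner_add_right: "cinner t (x + y) = cinner t x + cinner t y"
  by (simp add: cinner_def algebra_simps)

lemma integrable_cis:
  assumes "integrable M f" "g \<in> borel_measurable M"
  shows "integrable M (\<lambda>x. (f x :: real) *\<^sub>R cis (g x))"
  by (rule Bochner_Integration.integrable_bound[OF assms(1)]) (use assms in auto)

lemma norm_integral_cis_le: "norm (\<integral>x. (f x :: real) *\<^sub>R cis (g x) \<partial>M) \<le> (\<integral>x. \<bar>f x\<bar> \<partial>M)"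
  using integral_norm_bound[of M "\<lambda>x. f x *\<^sub>R cis (g x)"] by simp

text \<open>The bound does not involve the phase \<open>g\<close>, so an L1 approximation of the
  integrand is uniform over all frequencies.\<close>

lemma norm_integral_cis_diff_le:
  assumes "integrable M f" "integrable M h" "g \<in> borel_measurable M"
  shows "norm ((\<integral>x. (f x :: real) *\<^sub>R cis (g x) \<partial>M) - (\<integral>x. h x *\<^sub>R cis (g x) \<partial>M))
    \<le> (\<integral>x. \<bar>f x - h x\<bar> \<partial>M)"
proof -
  have "(\<integral>x. f x *\<^sub>R cis (g x) \<partial>M) - (\<integral>x. h x *\<^sub>R cis (g x) \<partial>M)
      = (\<integral>x. (f x - h x) *\<^sub>R cis (g x) \<partial>M)"
    using assms by (simp add: integrable_cis scaleR_diff_left)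
  then show ?thesis using norm_integral_cis_le[of M "\<lambda>x. f x - h x" g] by simp
qed

text \<open>The frontier of a convex set is null, and off it the indicator is locally constant, so
  the integrand vanishes eventually at almost every \<open>z\<close>. Along a sequence of shifts
  bounded by \<open>K\<close>, the set and its translates stay in the ball of radius
  \<open>B + K\<close>, whose indicator dominates.\<close>

lemma indicator_translate_L1_tendsto:
  fixes A :: "complex set"
  assumes A: "convex A" "bounded A" "A \<in> sets borel"
  shows "((\<lambda>h. \<integral>z. \<bar>indicator A z - indicator A (h + z) :: real\<bar> \<partial>lborel) \<longlongrightarrow> 0) (at 0)"
  unfolding tendsto_at_iff_sequentially
proof (intro allI impI, unfold comp_def)
  fix X :: "nat \<Rightarrow> complex" assume "\<forall>i. X i \<in> UNIV - {0}" and X: "X \<longlonglongrightarrow> 0"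
  obtain B where B: "\<And>z. z \<in> A \<Longrightarrow> norm z \<le> B"
    using A(2) by (auto simp: bounded_iff)
  obtain K where K: "\<And>i. norm (X i) \<le> K"
    using convergent_imp_bounded[OF X] by (auto simp: bounded_iff)
  note [measurable] = A(3)
  have "(\<lambda>i. \<integral>z. \<bar>indicator A z - indicator A (X i + z)\<bar> \<partial>lborel) \<longlonglongrightarrow> (\<integral>z. (0::real) \<partial>(lborel :: complex measure))"
  proof (rule integral_dominated_convergence[where w="indicator (cball 0 (B + K))"])
    show "integrable lborel (indicator (cball (0::complex) (B + K)) :: complex \<Rightarrow> real)"
      using emeasure_bounded_finite[OF bounded_cball, of "0::complex" "B + K"]
      by (intro integrable_real_indicator) auto
    have "frontier A \<in> null_sets lebesgue"
      using negligible_convex_frontier[OF A(1)] by (simp add: negligible_iff_null_sets)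
    then have "frontier A \<in> null_sets lborel"
      by (simp add: null_sets_completion_iff)
    then have "AE z in lborel. z \<notin> frontier A" by (rule AE_not_in)
    then show "AE z in lborel. (\<lambda>i. \<bar>indicator A z - indicator A (X i + z)\<bar>) \<longlonglongrightarrow> (0::real)"
    proof eventually_elim
      fix z assume z: "z \<notin> frontier A"
      have lim: "(\<lambda>i. X i + z) \<longlonglongrightarrow> z" using tendsto_add[OF X tendsto_const[of z]] by simp
      have "\<exists>U. open U \<and> z \<in> U \<and> (U \<subseteq> A \<or> U \<inter> A = {})"
      proof (cases "z \<in> interior A")
        case False
        then have "z \<in> - closure A" using z by (auto simp: frontier_def)
        then show ?thesis using closure_subset[of A] by (intro exI[of _ "- closure A"]) auto
      qed (auto simp: interior_def)
      then obtain U where U: "open U" "z \<in> U" "U \<subseteq> A \<or> U \<inter> A = {}" by blast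
      have "\<forall>\<^sub>F i in sequentially. X i + z \<in> U"
        using lim U(1,2) by (rule topological_tendstoD)
      then have "\<forall>\<^sub>F i in sequentially. \<bar>indicator A z - indicator A (X i + z)\<bar> = (0::real)"
        by eventually_elim (use U in \<open>auto simp: indicator_def\<close>)
      then show "(\<lambda>i. \<bar>indicator A z - indicator A (X i + z)\<bar>) \<longlonglongrightarrow> (0::real)"
        by (rule tendsto_eventually)
    qed
    show "AE z in lborel. norm \<bar>indicator A z - indicator A (X i + z) :: real\<bar>
            \<le> (indicator (cball 0 (B + K)) z :: real)" for i
    proof (rule AE_I2)
      fix z :: complex
      have "z \<notin> A" "X i + z \<notin> A" if "norm z > B + K"
      proof -
        show "z \<notin> A" using B[of z] K[of i] norm_ge_zero[of "X i"] that by force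
        have "norm z \<le> norm (X i + z) + norm (X i)"
          using norm_triangle_ineq4[of "X i + z" "X i"] by simp
        then show "X i + z \<notin> A" using B[of "X i + z"] K[of i] that by force
      qed
      then show "norm \<bar>indicator A z - indicator A (X i + z) :: real\<bar> \<le> (indicator (cball 0 (B + K)) z :: real)"
        by (auto simp: indicator_def)
    qed
  qed measurable
  then show "(\<lambda>i. \<integral>z. \<bar>indicator A z - indicator A (X i + z)\<bar> \<partial>lborel) \<longlonglongrightarrow> (0::real)"
    by simp
qed

lemma integral_lborel_translate:
  fixes f :: "complex \<Rightarrow> complex"
  assumes "f \<in> borel_measurable borel"
  shows "(\<integral>z. f (c + z) \<partial>lborel) = (\<integral>z. f z \<partial>lborel)"
proof -
  have "(\<integral>z. f z \<partial>lborel) = (\<integral>z. f z \<partial>distr lborel borel ((+) c))"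
    by (simp add: lborel_distr_plus)
  also have "\<dots> = (\<integral>z. f (c + z) \<partial>lborel)"
    using assms by (subst integral_distr) auto
  finally show ?thesis by simp
qed

text \<open>Translating by \<open>h = \<pi> t / |t|\<^sup>2\<close> changes the sign of the character \<open>z \<mapsto> e\<^bsup>i\<langle>t,z\<rangle>\<^esup>\<close>.\<close>

lemma Riemann_Lebesgue_convex:
  fixes A :: "complex set"
  assumes A: "convex A" "bounded A" "A \<in> sets borel"
  shows "((\<lambda>t. \<integral>z. indicator A z *\<^sub>R cis (cinner t z) \<partial>lborel) \<longlongrightarrow> 0) at_infinity"
proof -
  note [measurable] = A(3)
  define h :: "complex \<Rightarrow> complex" where "h t = of_real (pi / (norm t)\<^sup>2) * t" for t
  define D where "D h = (\<integral>z. \<bar>indicator A z - indicator A (h + z) :: real\<bar> \<partial>lborel)" for h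
  have nh: "norm (h t) = pi / norm t" for t
    by (simp add: h_def norm_mult norm_divide power2_eq_square)
  have "((\<lambda>t. norm (h t)) \<longlongrightarrow> 0) at_infinity"
    unfolding nh by (intro tendsto_divide_0[OF tendsto_const] filterlim_at_infinity_imp_norm_at_top
      filterlim_at_top_imp_at_infinity filterlim_norm_at_top)
  then have "(h \<longlongrightarrow> 0) at_infinity" by (simp add: tendsto_norm_zero_iff)
  moreover have ev: "\<forall>\<^sub>F t :: complex in at_infinity. t \<noteq> 0"
    unfolding eventually_at_infinity by (intro exI[of _ 1]) auto
  then have "\<forall>\<^sub>F t in at_infinity. h t \<noteq> 0"
    by eventually_elim (auto simp: h_def)
  ultimately have "filterlim h (at 0) at_infinity" by (simp add: filterlim_at)
  with indicator_translate_L1_tendsto[OF A] have "((\<lambda>t. D (h t)) \<longlongrightarrow> 0) at_infinity"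
    unfolding D_def by (rule filterlim_compose)
  then show ?thesis
  proof (rule Lim_null_comparison[rotated])
    show "\<forall>\<^sub>F t in at_infinity. norm (\<integral>z. indicator A z *\<^sub>R cis (cinner t z) \<partial>lborel) \<le> D (h t)"
      using ev
    proof eventually_elim
      case (elim t)
      have int: "integrable lborel (indicator A :: _ \<Rightarrow> real)"
        using A(2) by (intro integrable_real_indicator emeasure_bounded_finite) auto
      have "integrable (distr lborel borel ((+) (h t))) (indicator A :: _ \<Rightarrow> real)"
        using int by (simp add: lborel_distr_plus)
      then have int2: "integrable lborel (\<lambda>z. indicator A (h t + z) :: real)"
        by (subst (asm) integrable_distr_eq) auto
      have ph: "cinner t (h t) = pi"
      proof -
        have "cnj t * h t = of_real (pi / (norm t)\<^sup>2) * (t * cnj t)" by (simp add: h_def)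
        also have "\<dots> = of_real (pi / (norm t)\<^sup>2 * (norm t)\<^sup>2)"
          by (simp only: complex_norm_square[symmetric] of_real_mult of_real_power)
        also have "\<dots> = of_real pi" using elim by simp
        finally show ?thesis by (simp add: cinner_def)
      qed
      let ?I = "\<integral>z. indicator A z *\<^sub>R cis (cinner t z) \<partial>lborel"
      have "?I = (\<integral>z. indicator A (h t + z) *\<^sub>R cis (cinner t (h t + z)) \<partial>lborel)"
        by (subst integral_lborel_translate) auto
      also have "\<dots> = (\<integral>z. - (indicator A (h t + z) *\<^sub>R cis (cinner t z)) \<partial>lborel)"
        by (simp add: cinner_add_right ph cis_mult[symmetric] del: of_real_mult)
      also have "\<dots> = - (\<integral>z. indicator A (h t + z) *\<^sub>R cis (cinner t z) \<partial>lborel)" by simp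
      \<comment> \<open>The sign change makes twice the integral a difference of integrals against
        the same character, which the L1 distance of the two indicators controls.\<close>
      finally have "2 * ?I = ?I - (\<integral>z. indicator A (h t + z) *\<^sub>R cis (cinner t z) \<partial>lborel)" by simp
      also have "norm \<dots> \<le> D (h t)"
        unfolding D_def by (intro norm_integral_cis_diff_le int int2) measurable
      finally have "2 * norm ?I \<le> D (h t)" by (simp add: norm_mult)
      then show ?case using norm_ge_zero[of ?I] by linarith
    qed
  qed
qed

text \<open>A Dynkin argument: boxes form an intersection-stable generator, and a box cut with
  \<open>B\<close> is convex and bounded. Cutting with \<open>B\<close> keeps all measures finite,
  as the complement step and the summable bound for disjoint unions require.\<close>

lemma Riemann_Lebesgue_bounded_set:
  fixes A :: "complex set"
  assumes "A \<in> sets borel" and B: "convex B" "bounded B" "B \<in> sets borel"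
  shows "((\<lambda>t. \<integral>z. indicator (A \<inter> B) z *\<^sub>R cis (cinner t z) \<partial>lborel) \<longlongrightarrow> 0) at_infinity"
proof -
  let ?G = "range (\<lambda>(a, b). box a b :: complex set)"
  have sb: "sigma_sets UNIV ?G = sets borel"
    by (subst borel_eq_box) simp
  have fin: "integrable lborel (indicator (A \<inter> B) :: _ \<Rightarrow> real)" if "A \<in> sets borel" for A
    using B that by (intro integrable_real_indicator emeasure_bounded_finite) (auto intro: bounded_subset)
  have "Int_stable ?G"
    by (auto simp: Int_stable_def box_Int_box)
  moreover have "?G \<subseteq> Pow UNIV" by simp
  moreover have "A \<in> sigma_sets UNIV ?G" using assms(1) sb by simp
  ultimately show ?thesis
  proof (induction rule: sigma_sets_induct_disjoint)
    case (basic A)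
    then obtain a b where "A = box a b" by auto
    then show ?case
      using B by (intro Riemann_Lebesgue_convex convex_Int) (auto intro: bounded_subset)
  next
    case (compl A)
    have A: "A \<in> sets borel" using compl.hyps sb by simp
    have "((\<lambda>t. (\<integral>z. indicator B z *\<^sub>R cis (cinner t z) \<partial>lborel)
          - (\<integral>z. indicator (A \<inter> B) z *\<^sub>R cis (cinner t z) \<partial>lborel)) \<longlongrightarrow> 0 - 0) at_infinity"
      by (intro tendsto_diff compl Riemann_Lebesgue_convex B)
    moreover have "(\<integral>z. indicator B z *\<^sub>R cis (cinner t z) \<partial>lborel)
          - (\<integral>z. indicator (A \<inter> B) z *\<^sub>R cis (cinner t z) \<partial>lborel) =
          (\<integral>z. indicator ((UNIV - A) \<inter> B) z *\<^sub>R cis (cinner t z) \<partial>lborel)" for t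
      using fin[of UNIV] fin[OF A]
      by (subst Bochner_Integration.integral_diff[symmetric]; (intro integrable_cis)?)
         (auto intro!: Bochner_Integration.integral_cong split: split_indicator)
    ultimately show ?case by simp
  next
    case (union A)
    have A[measurable]: "A i \<in> sets borel" for i using union.hyps(2) sb by auto
    note [measurable] = B(3)
    have dis: "disjoint_family (\<lambda>i. A i \<inter> B)"
      using union.hyps(1) by (auto simp: disjoint_family_on_def)
    have fm: "A i \<inter> B \<in> fmeasurable lborel" "(\<Union>i. A i \<inter> B) \<in> fmeasurable lborel" for i
      using B(2) by (auto intro!: fmeasurableI emeasure_bounded_finite intro: bounded_subset)
    have sm: "(\<lambda>i. measure lborel (A i \<inter> B)) sums measure lborel (\<Union>i. A i \<inter> B)"
      using fm dis by (intro measure_UNION) (auto simp: fmeasurable_def)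
    have I: "(\<integral>z. indicator ((\<Union>i. A i) \<inter> B) z *\<^sub>R cis (cinner t z) \<partial>lborel)
        = (\<Sum>i. \<integral>z. indicator (A i \<inter> B) z *\<^sub>R cis (cinner t z) \<partial>lborel)" for t
    proof -
      have "set_lebesgue_integral lborel (\<Union>i. A i \<inter> B) (\<lambda>z. cis (cinner t z)) =
          (\<Sum>i. set_lebesgue_integral lborel (A i \<inter> B) (\<lambda>z. cis (cinner t z)))"
      proof (rule lebesgue_integral_countable_add)
        show "set_integrable lborel (\<Union>i. A i \<inter> B) (\<lambda>z. cis (cinner t z))"
          unfolding set_integrable_def using fin[of "\<Union>i. A i"]
          by (intro integrable_cis) auto
      qed (use dis in \<open>auto simp: disjoint_family_on_def\<close>)
      then show ?thesis by (simp add: set_lebesgue_integral_def)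
    qed
    \<comment> \<open>Each term is at most the measure of its piece, whatever \<open>t\<close> is;
      these measures are summable, so the limit passes through the series.\<close>
    have "((\<lambda>t. \<Sum>i. \<integral>z. indicator (A i \<inter> B) z *\<^sub>R cis (cinner t z) \<partial>lborel) \<longlongrightarrow> (\<Sum>i::nat. 0)) at_infinity"
    proof (rule tannerys_theorem[THEN conjunct2, THEN conjunct2])
      show "summable (\<lambda>i. measure lborel (A i \<inter> B))" using sm by (rule sums_summable)
      have "norm (\<integral>z. indicator (A i \<inter> B) z *\<^sub>R cis (cinner t z) \<partial>lborel) \<le> measure lborel (A i \<inter> B)" for i t
        using norm_integral_cis_le[of lborel "indicator (A i \<inter> B)" "cinner t"] by simp
      then show "\<forall>\<^sub>F (k, t) in sequentially \<times>\<^sub>F at_infinity.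
          norm (\<integral>z. indicator (A k \<inter> B) z *\<^sub>R cis (cinner t z) \<partial>lborel) \<le> measure lborel (A k \<inter> B)"
        by (intro always_eventually) auto
    qed (use union.IH in \<open>auto simp: trivial_limit_at_infinity\<close>)
    then show ?case by (simp add: I)
  qed simp
qed

text \<open>The error \<open>e n\<close> is independent of \<open>t\<close>. This passes the
  Riemann-Lebesgue limit first from bounded sets to sets of finite measure, then from simple to
  integrable functions.\<close>

lemma tendsto_0_uniform_limit:
  fixes F :: "nat \<Rightarrow> 'a \<Rightarrow> 'b::real_normed_vector"
  assumes lim: "\<And>n. (F n \<longlongrightarrow> 0) net" and e: "e \<longlonglongrightarrow> 0" and le: "\<And>n t. norm (G t - F n t) \<le> e n"
  shows "(G \<longlongrightarrow> 0) net"
proof (rule tendstoI)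
  fix r :: real assume "0 < r"
  then have "\<forall>\<^sub>F n in sequentially. dist (e n) 0 < r / 2"
    using e by (intro tendstoD) auto
  then obtain n where n: "\<bar>e n\<bar> < r / 2" by (auto simp: eventually_sequentially)
  have "\<forall>\<^sub>F t in net. dist (F n t) 0 < r / 2"
    using lim \<open>0 < r\<close> by (intro tendstoD) auto
  then show "\<forall>\<^sub>F t in net. dist (G t) 0 < r"
  proof eventually_elim
    case (elim t)
    have "norm (G t) \<le> norm (G t - F n t) + norm (F n t)"
      using norm_triangle_ineq[of "G t - F n t" "F n t"] by simp
    with le[of t n] elim n show ?case by simp
  qed
qed

theorem Riemann_Lebesgue:
  fixes f :: "complex \<Rightarrow> real"
  assumes "integrable lborel f"
  shows "((\<lambda>t. \<integral>z. f z *\<^sub>R cis (cinner t z) \<partial>lborel) \<longlongrightarrow> 0) at_infinity"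
  using assms
proof (induction rule: integrable_induct)
  case (base A c)
  have [measurable]: "A \<in> sets borel" using base by simp
  \<comment> \<open>A set of finite measure may be unbounded, so it is truncated by growing
    balls.\<close>
  let ?B = "\<lambda>n. cball 0 (real n) :: complex set"
  have fin: "integrable lborel (indicator A :: _ \<Rightarrow> real)"
    using base by (intro integrable_real_indicator) auto
  have fin': "integrable lborel (indicator (A \<inter> C) :: _ \<Rightarrow> real)" if "C \<in> sets borel" for C
    using that by (intro Bochner_Integration.integrable_bound[OF fin]) (auto simp: indicator_def)
  have "((\<lambda>t. \<integral>z. indicator A z *\<^sub>R cis (cinner t z) \<partial>lborel) \<longlongrightarrow> 0) at_infinity"
  proof (rule tendsto_0_uniform_limit)
    show "((\<lambda>t. \<integral>z. indicator (A \<inter> ?B n) z *\<^sub>R cis (cinner t z) \<partial>lborel) \<longlongrightarrow> 0) at_infinity" for n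
      by (intro Riemann_Lebesgue_bounded_set) auto
    show "(\<lambda>n. \<integral>z. \<bar>indicator A z - indicator (A \<inter> ?B n) z :: real\<bar> \<partial>lborel) \<longlonglongrightarrow> 0"
    proof -
      have "(\<lambda>n. \<integral>z. \<bar>indicator A z - indicator (A \<inter> ?B n) z :: real\<bar> \<partial>lborel) \<longlonglongrightarrow> (\<integral>z. (0::real) \<partial>(lborel :: complex measure))"
      proof (rule integral_dominated_convergence[OF _ _ fin])
        show "AE z in lborel. (\<lambda>n. \<bar>indicator A z - indicator (A \<inter> ?B n) z :: real\<bar>) \<longlonglongrightarrow> 0"
        proof (rule AE_I2, rule tendsto_eventually)
          fix z :: complex
          obtain N where "norm z \<le> real N" using real_arch_simple by blast
          then show "\<forall>\<^sub>F n in sequentially. \<bar>indicator A z - indicator (A \<inter> ?B n) z :: real\<bar> = 0"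
            unfolding eventually_sequentially by (intro exI[of _ N]) (auto simp: indicator_def)
        qed
      qed (auto simp: indicator_def)
      then show ?thesis by simp
    qed
    show "norm ((\<integral>z. indicator A z *\<^sub>R cis (cinner t z) \<partial>lborel) - (\<integral>z. indicator (A \<inter> ?B n) z *\<^sub>R cis (cinner t z) \<partial>lborel))
        \<le> (\<integral>z. \<bar>indicator A z - indicator (A \<inter> ?B n) z :: real\<bar> \<partial>lborel)" for n t
      by (intro norm_integral_cis_diff_le fin fin') auto
  qed
  then have "((\<lambda>t. c *\<^sub>R (\<integral>z. indicator A z *\<^sub>R cis (cinner t z) \<partial>lborel)) \<longlongrightarrow> c *\<^sub>R 0) at_infinity"
    by (intro tendsto_intros)
  then show ?case
    by (simp add: mult.commute flip: scaleR_scaleR integral_scaleR_right)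
next
  case (add f g)
  have "((\<lambda>t. (\<integral>z. f z *\<^sub>R cis (cinner t z) \<partial>lborel) + (\<integral>z. g z *\<^sub>R cis (cinner t z) \<partial>lborel)) \<longlongrightarrow> 0 + 0) at_infinity"
    by (intro tendsto_add add.IH)
  moreover have "(\<integral>z. f z *\<^sub>R cis (cinner t z) \<partial>lborel) + (\<integral>z. g z *\<^sub>R cis (cinner t z) \<partial>lborel)
      = (\<integral>z. (f z + g z) *\<^sub>R cis (cinner t z) \<partial>lborel)" for t
    using add.hyps by (subst Bochner_Integration.integral_add[symmetric]) (auto intro!: integrable_cis simp: scaleR_add_left)
  ultimately show ?case by simp
next
  case (lim f s)
  show ?case
  proof (rule tendsto_0_uniform_limit)
    show "((\<lambda>t. \<integral>z. s n z *\<^sub>R cis (cinner t z) \<partial>lborel) \<longlongrightarrow> 0) at_infinity" for n by (rule lim.IH)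
    have [measurable]: "f \<in> borel_measurable borel" "\<And>n. s n \<in> borel_measurable borel"
      using lim.hyps by auto
    have "(\<lambda>n. \<integral>z. \<bar>f z - s n z\<bar> \<partial>lborel) \<longlonglongrightarrow> (\<integral>z. (0::real) \<partial>(lborel :: complex measure))"
    \<comment> \<open>The approximating functions satisfy
      \<open>\<bar>s n z\<bar> \<le> 2 * \<bar>f z\<bar>\<close>, which gives the factor 3.\<close>
    proof (rule integral_dominated_convergence[where w="\<lambda>z. 3 * \<bar>f z\<bar>"])
      show "integrable lborel (\<lambda>z. 3 * \<bar>f z\<bar>)" using lim.hyps(4) by auto
      show "AE z in lborel. (\<lambda>n. \<bar>f z - s n z\<bar>) \<longlonglongrightarrow> 0"
      proof (rule AE_I2)
        fix z :: complex
        have "(\<lambda>n. \<bar>f z - s n z\<bar>) \<longlonglongrightarrow> \<bar>f z - f z\<bar>" by (intro tendsto_intros lim.hyps) simp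
        then show "(\<lambda>n. \<bar>f z - s n z\<bar>) \<longlonglongrightarrow> 0" by simp
      qed
      show "AE z in lborel. norm \<bar>f z - s n z\<bar> \<le> 3 * \<bar>f z\<bar>" for n
      proof (rule AE_I2)
        fix z :: complex
        show "norm \<bar>f z - s n z\<bar> \<le> 3 * \<bar>f z\<bar>" using lim.hyps(3)[of z n] by auto
      qed
    qed measurable
    then show "(\<lambda>n. \<integral>z. \<bar>f z - s n z\<bar> \<partial>lborel) \<longlonglongrightarrow> 0" by simp
    show "norm ((\<integral>z. f z *\<^sub>R cis (cinner t z) \<partial>lborel) - (\<integral>z. s n z *\<^sub>R cis (cinner t z) \<partial>lborel))
        \<le> (\<integral>z. \<bar>f z - s n z\<bar> \<partial>lborel)" for n t
      by (intro norm_integral_cis_diff_le lim.hyps) auto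
  qed
qed

section \<open>Sums of two points on logarithmic spirals\<close>

lemma null_sets_lborel_iff_negligible:
  "N \<in> sets borel \<Longrightarrow> N \<in> null_sets lborel \<longleftrightarrow> negligible N"
  by (simp add: negligible_iff_null_sets null_sets_completion_iff)

lemma countable_sin_affine_zeros:
  fixes w a :: real
  assumes "w \<noteq> 0"
  shows "countable {x. sin (w * x + a) = 0}"
proof -
  have "{x. sin (w * x + a) = 0} \<subseteq> (\<lambda>n::int. (of_int n * pi - a) / w) ` UNIV"
  proof
    fix x assume "x \<in> {x. sin (w * x + a) = 0}"
    then obtain n :: int where "w * x + a = of_int n * pi"
      by (auto simp: sin_zero_iff_int2)
    then show "x \<in> (\<lambda>n::int. (of_int n * pi - a) / w) ` UNIV"
      using assms by (intro image_eqI[of _ _ n]) (auto simp: field_simps)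
  qed
  then show ?thesis by (rule countable_subset) simp
qed

text \<open>In polar form the modulus never vanishes when \<open>c\<close> is nonzero, so the zeros
  in \<open>x\<close> are those of the sine factor: countably many once \<open>Im z\<close> is
  nonzero.\<close>

lemma Im_mult_exp:
  "Im (c * exp (z * of_real x)) = norm c * exp (Re z * x) * sin (Im z * x + Arg c)"
proof -
  have "c * exp (z * of_real x) = of_real (norm c * exp (Re z * x)) * cis (Im z * x + Arg c)"
    by (subst (1) rcis_cmod_Arg[of c, symmetric])
       (simp add: rcis_def exp_eq_polar[of "z * of_real x"] cis_mult add.commute)
  then show ?thesis by simp
qed

text \<open>The Jacobian of the map \<open>(x, y) \<mapsto> e\<^bsup>-\<lambda>y\<^esup>(e\<^bsup>-\<lambda>x\<^esup>s + w)\<close> vanishes only where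
  \<open>e\<^bsup>-\<lambda>x\<^esup>s\<close> and \<open>w\<close> are parallel, that is, for countably many \<open>x\<close>.\<close>

lemma spiral_sum_AE_not_in_null_set:
  fixes lam s w :: complex
  assumes lam: "Im lam \<noteq> 0" and sw: "s \<noteq> 0" "w \<noteq> 0" and N: "N \<in> null_sets lborel"
  shows "AE x in lborel. AE y in lborel.
    exp (- (lam * of_real y)) * (exp (- (lam * of_real x)) * s + w) \<notin> N"
proof -
  \<comment> \<open>With this \<open>c\<close>, the imaginary part of
    \<open>c * exp (- lam * x)\<close> vanishes exactly when \<open>exp (- lam * x) * s\<close> and
    \<open>w\<close> are parallel over the reals. Those \<open>x\<close> form \<open>E\<close>, and
    \<open>S\<close> removes the corresponding lines. \<open>G\<close> is the derivative of
    \<open>F\<close>.\<close>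
  define c where "c = cnj w * s"
  define E where "E = {x::real. sin (Im (- lam) * x + Arg c) = 0}"
  define S :: "(real \<times> real) set" where "S = (- E) \<times> UNIV"
  define F where "F x y = exp (- (lam * of_real y)) * (exp (- (lam * of_real x)) * s + w)" for x y :: real
  define f where "f p = (Re (F (fst p) (snd p)), Im (F (fst p) (snd p)))" for p :: "real \<times> real"
  define G where "G p q = - lam * (of_real (fst q) * (exp (- (lam * of_real (snd p))) * exp (- (lam * of_real (fst p))) * s)
      + of_real (snd q) * F (fst p) (snd p))" for p q :: "real \<times> real"
  define f' where "f' p q = (Re (G p q), Im (G p q))" for p q :: "real \<times> real"
  have [measurable]: "N \<in> sets borel" using N by auto
  have "c \<noteq> 0" using sw by (simp add: c_def)
  have "countable E" using lam unfolding E_def by (intro countable_sin_affine_zeros) simp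
  have E: "x \<in> E \<longleftrightarrow> Im (c * exp (- (lam * of_real x))) = 0" for x
    using Im_mult_exp[of c "- lam" x] \<open>c \<noteq> 0\<close> by (simp add: E_def)
  have neg: "negligible N"
    using N by (simp add: null_sets_lborel_iff_negligible)
  \<comment> \<open>The map \<open>f\<close> goes from pairs of reals to pairs of reals, so
    \<open>N\<close> is carried over to that space.\<close>
  define T where "T = (\<lambda>z. (Re z, Im z)) ` N"
  have "negligible T" unfolding T_def
  proof (rule negligible_differentiable_image_negligible[OF _ neg])
    show "(\<lambda>z. (Re z, Im z)) differentiable_on N"
      unfolding differentiable_on_def
      by (intro ballI differentiableI[of _ "\<lambda>z. (Re z, Im z)"] has_derivative_Pair) (auto intro!: derivative_eq_intros)
  qed simp
  have ex: "((\<lambda>p. exp (- (lam * of_real (g p)))) has_derivative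
      (\<lambda>q. - (lam * of_real (g q)) * exp (- (lam * of_real (g p))))) (at p within S)"
    if "bounded_linear g" for g :: "real \<times> real \<Rightarrow> real" and p
  proof -
    have "((\<lambda>p. - (lam * of_real (g p))) has_derivative (\<lambda>q. - (lam * of_real (g q)))) (at p within S)"
      by (auto intro!: derivative_eq_intros bounded_linear_imp_has_derivative[OF that])
    from has_derivative_compose[OF this DERIV_exp[unfolded has_field_derivative_def]] show ?thesis
      by (simp add: mult.commute)
  qed
  have der: "((\<lambda>p. F (fst p) (snd p)) has_derivative G p) (at p within S)" for p
    unfolding F_def G_def[abs_def]
    by (auto intro!: derivative_eq_intros ex bounded_linear_fst bounded_linear_snd simp: algebra_simps)
  have neg_T: "negligible {p \<in> S. f p \<in> T}"
  proof (rule negligible_differentiable_vimage[OF \<open>negligible T\<close>, where f' = f'])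
    fix p assume p: "p \<in> S"
    show "(f has_derivative f' p) (at p within S)"
      unfolding f_def[abs_def] f'_def[abs_def]
      by (intro has_derivative_Pair has_derivative_Re has_derivative_Im der)
    obtain x y where xy: "p = (x, y)" by (cases p)
    have "linear (f' p)"
      using \<open>(f has_derivative f' p) (at p within S)\<close> by (rule has_derivative_linear)
    then show "inj (f' p)"
    proof (subst linear_injective_0, assumption, intro allI impI)
      fix q assume "f' p q = 0"
      then have "G p q = 0" by (simp add: f'_def complex_eq_iff zero_prod_def)
      obtain a b where q: "q = (a, b)" by (cases q)
      let ?u = "exp (- (lam * of_real x)) * s"
      have "lam \<noteq> 0" using lam by auto
      have "G p q = - lam * exp (- (lam * of_real y)) * (of_real a * ?u + of_real b * (?u + w))"
        by (simp add: G_def F_def xy q algebra_simps)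
      with \<open>G p q = 0\<close> \<open>lam \<noteq> 0\<close> have "of_real a * ?u + of_real b * (?u + w) = 0" by simp
      then have *: "of_real (a + b) * ?u = - of_real b * w"
        by (simp add: eq_neg_iff_add_eq_0 algebra_simps)
      \<comment> \<open>Multiplying by \<open>cnj w\<close> makes the right-hand side real. Taking
        imaginary parts then forces \<open>a + b = 0\<close> for \<open>x\<close> outside
        \<open>E\<close>, and \<open>b * w = 0\<close> remains.\<close>
      then have "cnj w * (of_real (a + b) * ?u) = - of_real b * (w * cnj w)" by simp
      then have "of_real (a + b) * (c * exp (- (lam * of_real x))) = - of_real b * of_real ((norm w)\<^sup>2)"
        unfolding complex_norm_square by (simp add: c_def mult_ac)
      then have "Im (of_real (a + b) * (c * exp (- (lam * of_real x)))) = 0" by simp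
      then have "(a + b) * Im (c * exp (- (lam * of_real x))) = 0"
        by (simp del: of_real_add)
      moreover have "x \<notin> E" using p by (simp add: S_def xy)
      ultimately have "a + b = 0" using E by simp
      with * sw have "b = 0" by simp
      with \<open>a + b = 0\<close> show "q = 0" by (simp add: q zero_prod_def)
    qed
  qed
  have fT: "f (x, y) \<in> T \<longleftrightarrow> F x y \<in> N" for x y
    by (auto simp: f_def T_def image_iff complex_eq_iff) (metis complex_surj)
  have [measurable]: "case_prod F \<in> borel_measurable (lborel \<Otimes>\<^sub>M lborel)"
    unfolding F_def[abs_def] split_beta'
    by (intro borel_measurable_continuous_onI continuous_intros | simp add: lborel_prod)+
  have "E \<in> sets borel" "emeasure lborel E = 0"
    using \<open>countable E\<close> by (auto intro: emeasure_lborel_countable sets.countable)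
  then have "E \<in> null_sets lborel" by (intro null_setsI) auto
  then have AE_E: "AE x in lborel. x \<notin> E" by (rule AE_not_in)
  have "{p \<in> S. f p \<in> T} = {p \<in> S. F (fst p) (snd p) \<in> N}"
    using fT by auto
  with neg_T have "negligible {p \<in> S. F (fst p) (snd p) \<in> N}" by simp
  moreover have meas: "{p \<in> S. F (fst p) (snd p) \<in> N} \<in> sets borel"
  proof -
    have "{p \<in> space (lborel \<Otimes>\<^sub>M lborel). fst p \<notin> E \<and> case_prod F p \<in> N} \<in> sets (lborel \<Otimes>\<^sub>M lborel)"
      using \<open>E \<in> sets borel\<close> by measurable
    also have "{p \<in> space (lborel \<Otimes>\<^sub>M lborel). fst p \<notin> E \<and> case_prod F p \<in> N} = {p \<in> S. F (fst p) (snd p) \<in> N}"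
      by (auto simp: S_def lborel_prod)
    finally show ?thesis using sets_lborel by (metis lborel_prod)
  qed
  ultimately have "{p \<in> S. F (fst p) (snd p) \<in> N} \<in> null_sets (lborel \<Otimes>\<^sub>M lborel)"
    by (simp add: null_sets_lborel_iff_negligible lborel_prod)
  then have "AE p in lborel \<Otimes>\<^sub>M lborel. p \<notin> {p \<in> S. F (fst p) (snd p) \<in> N}"
    by (rule AE_not_in)
  then have "AE x in lborel. AE y in lborel. (x, y) \<notin> {p \<in> S. F (fst p) (snd p) \<in> N}"
    by (rule lborel_pair.AE_pair)
  then have "AE x in lborel. AE y in lborel. F x y \<notin> N"
    using AE_E by eventually_elim (auto simp: S_def)
  then show ?thesis by (simp add: F_def)
qed

section \<open>The law of T\<close>

text \<open>The index 0, for which the exponential density degenerates to the zero measure, is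
  redirected to 1, so that the whole family consists of probability measures.\<close>

definition expo :: "nat \<Rightarrow> real measure" where
  "expo j = density lborel (\<lambda>x. ennreal (exponential_density (real (max 1 j)) x))"

lemma sets_expo [measurable_cong, simp]: "sets (expo j) = sets borel"
  and space_expo [simp]: "space (expo j) = UNIV"
  by (simp_all add: expo_def)

lemma prob_space_expo: "prob_space (expo j)"
  unfolding expo_def by (intro prob_space_exponential_density) auto

interpretation expo: product_prob_space expo UNIV
  by (simp add: product_prob_space_def product_prob_space_axioms_def product_sigma_finite_def
      prob_space_expo prob_space_imp_sigma_finite)

lemma T_law_eq: "T_law m = distr (PiM {1..m-1} expo) borel (\<lambda>x. \<Sum>j\<in>{1..m-1}. x j)"
  unfolding T_law_def
  by (intro arg_cong3[where f=distr] PiM_cong refl) (auto simp: expo_def max_def)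

lemma sets_T_law [measurable_cong, simp]: "sets (T_law m) = sets borel"
  and space_T_law [simp]: "space (T_law m) = UNIV"
  by (simp_all add: T_law_def)

lemma prob_space_T_law: "prob_space (T_law m)"
  unfolding T_law_eq
  by (intro prob_space.prob_space_distr prob_space_PiM prob_space_expo) measurable

text \<open>Exponential tilting: multiplying the density of rate \<open>r\<close> by
  \<open>exp (- (s * x))\<close> gives \<open>r / (r + s)\<close> times the density of rate
  \<open>r + s\<close>. All rates are at least 1, so \<open>s > -1\<close> suffices; negative
  \<open>s\<close> yields exponential moments.\<close>

lemma nn_integral_expo_exp:
  assumes "s > -1"
  shows "(\<integral>\<^sup>+x. ennreal (exp (- (s * x))) \<partial>expo j) = ennreal (real (max 1 j) / (real (max 1 j) + s))"
proof -
  define r where "r = real (max 1 j)"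
  have r: "r > 0" "r + s > 0" using assms by (auto simp: r_def)
  have "(\<integral>\<^sup>+x. ennreal (exp (- (s * x))) \<partial>expo j)
      = (\<integral>\<^sup>+x. ennreal (exponential_density r x) * ennreal (exp (- (s * x))) \<partial>lborel)"
    unfolding expo_def r_def[symmetric] by (subst nn_integral_density) auto
  also have "\<dots> = (\<integral>\<^sup>+x. ennreal (r / (r + s)) * ennreal (exponential_density (r + s) x) \<partial>lborel)"
  proof (intro nn_integral_cong)
    fix x
    have "exponential_density r x * exp (- (s * x)) = r / (r + s) * exponential_density (r + s) x"
      using r by (simp add: exponential_density_def algebra_simps flip: exp_add)
         (simp add: field_simps)
    then show "ennreal (exponential_density r x) * ennreal (exp (- (s * x)))
        = ennreal (r / (r + s)) * ennreal (exponential_density (r + s) x)"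
      using r by (simp add: exponential_density_nonneg flip: ennreal_mult)
  qed
  also have "\<dots> = ennreal (r / (r + s)) * emeasure (density lborel (exponential_density (r + s))) UNIV"
    by (simp add: nn_integral_cmult emeasure_density)
  also have "\<dots> = ennreal (r / (r + s))"
    using prob_space.emeasure_space_1[OF prob_space_exponential_density[OF r(2)]] by simp
  finally show ?thesis by (simp add: r_def)
qed

text \<open>Independence turns the exponential of the sum into a product. Positive \<open>s\<close>
  serves the mean equation, negative \<open>s\<close> the Fourier decay.\<close>

lemma nn_integral_T_law_exp:
  assumes "s > -1"
  shows "(\<integral>\<^sup>+t. ennreal (exp (- (s * t))) \<partial>T_law m) = ennreal (\<Prod>j\<in>{1..m-1}. real j / (real j + s))"
proof -
  have "(\<integral>\<^sup>+t. ennreal (exp (- (s * t))) \<partial>T_law m)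
      = (\<integral>\<^sup>+x. (\<Prod>j\<in>{1..m-1}. ennreal (exp (- (s * x j)))) \<partial>PiM {1..m-1} expo)"
    unfolding T_law_eq
    by (subst nn_integral_distr)
       (auto simp: prod_ennreal exp_sum[symmetric] sum_distrib_left sum_negf intro!: nn_integral_cong)
  also have "\<dots> = (\<Prod>j\<in>{1..m-1}. \<integral>\<^sup>+x. ennreal (exp (- (s * x))) \<partial>expo j)"
    by (subst expo.product_nn_integral_prod) auto
  also have "\<dots> = (\<Prod>j\<in>{1..m-1}. ennreal (real j / (real j + s)))"
    using assms by (intro prod.cong refl) (auto simp: nn_integral_expo_exp max_def)
  also have "\<dots> = ennreal (\<Prod>j\<in>{1..m-1}. real j / (real j + s))"
    using assms by (intro prod_ennreal) auto
  finally show ?thesis .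
qed

text \<open>Given the other summands, \<open>T\<close> is a translate of the first exponential
  variable, which has a density. The hypothesis \<open>m \<ge> 2\<close> ensures that this summand
  is present.\<close>

lemma absolutely_continuous_T_law:
  assumes "m \<ge> 2"
  shows "absolutely_continuous lborel (T_law m)"
  unfolding absolutely_continuous_def
proof
  fix N :: "real set" assume N: "N \<in> null_sets lborel"
  then have [measurable]: "N \<in> sets borel" by auto
  define I where "I = {2..m-1}"
  have I: "{1..m-1} = insert 1 I" "finite I" "1 \<notin> I" using assms by (auto simp: I_def)
  have "(\<lambda>y. y + c) -` N \<in> null_sets lborel" for c
  proof (rule null_setsI)
    have "N \<in> null_sets (distr lborel borel ((+) c))" using N by (simp add: lborel_distr_plus)
    then show "emeasure lborel ((\<lambda>y. y + c) -` N) = 0"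
      by (auto simp: null_sets_def emeasure_distr vimage_def add.commute)
  qed (use measurable_sets[of "\<lambda>y. y + c" borel borel N] in simp)
  then have "AE y in lborel. y + c \<notin> N" for c
    using AE_not_in[of "(\<lambda>y. y + c) -` N" lborel] by simp
  then have tr: "AE y in expo j. y + c \<notin> N" for c j
    unfolding expo_def by (subst AE_density) (auto intro: eventually_mono)
  have "emeasure (T_law m) N = (\<integral>\<^sup>+x. indicator N (\<Sum>j\<in>insert 1 I. x j) \<partial>PiM (insert 1 I) expo)"
    unfolding T_law_eq I
    by (subst nn_integral_indicator[symmetric], simp, subst nn_integral_distr) auto
  also have "\<dots> = (\<integral>\<^sup>+x. \<integral>\<^sup>+y. indicator N (\<Sum>j\<in>insert 1 I. (x(1 := y)) j) \<partial>expo 1 \<partial>PiM I expo)"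
    using I by (intro expo.product_nn_integral_insert) auto
  also have "\<dots> = (\<integral>\<^sup>+x. \<integral>\<^sup>+y. indicator N (y + (\<Sum>j\<in>I. x j)) \<partial>expo 1 \<partial>PiM I expo)"
    using I by (intro nn_integral_cong) (auto intro!: arg_cong[where f="indicator N"] sum.cong)
  also have "\<dots> = (\<integral>\<^sup>+x. 0 \<partial>PiM I expo)"
    using tr by (intro nn_integral_cong, subst nn_integral_0_iff_AE) (auto simp: indicator_def)
  finally show "N \<in> null_sets (T_law m)" by (intro null_setsI) auto
qed

lemma emeasure_expo_ball_pos:
  assumes "c > 0" "e > 0"
  shows "emeasure (expo j) (ball c e) > 0"
proof (rule ccontr)
  define r where "r = real (max 1 j)"
  have r: "r > 0" by (simp add: r_def)
  assume "\<not> emeasure (expo j) (ball c e) > 0"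
  then have "emeasure (expo j) (ball c e) = 0" by (simp add: not_gr_zero)
  then have "ball c e \<in> null_sets (density lborel (exponential_density r))"
    by (intro null_setsI) (auto simp: expo_def r_def)
  then have "AE x in lborel. x \<in> ball c e \<longrightarrow> ennreal (exponential_density r x) = 0"
    by (subst (asm) null_sets_density_iff) auto
  \<comment> \<open>This part of the ball lies in the positive half-line, where the density is
    strictly positive.\<close>
  then have "AE x in lborel. x \<notin> {max 0 (c - e)<..<c}"
    by eventually_elim (use r assms in \<open>auto simp: exponential_density_def dist_real_def ennreal_eq_0_iff max_def mult_le_0_iff split: if_splits\<close>)
  then have "emeasure lborel {max 0 (c - e)<..<c} = 0"
    by (subst (asm) AE_iff_null_sets[symmetric]) auto
  then show False using assms by (auto simp: max_def split: if_splits)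
qed

text \<open>If each of the \<open>n\<close> summands lies within \<open>e / n\<close> of
  \<open>t / n\<close>, the sum lies within \<open>e\<close> of \<open>t\<close>; by independence
  this event has positive probability.\<close>

lemma emeasure_T_law_ball_pos:
  assumes "m \<ge> 2" "t > 0" "e > 0"
  shows "emeasure (T_law m) (ball t e) > 0"
proof -
  define J where "J = {1..m-1}"
  define n where "n = real (card J)"
  have J: "finite J" "J \<noteq> {}" "n > 0" using assms by (auto simp: J_def n_def)
  let ?B = "Pi\<^sub>E J (\<lambda>_. ball (t / n) (e / n))"
  have sub: "?B \<subseteq> (\<lambda>x. \<Sum>j\<in>J. x j) -` ball t e \<inter> space (PiM J expo)"
  proof
    fix x assume x: "x \<in> ?B"
    have "\<bar>t - (\<Sum>j\<in>J. x j)\<bar> = \<bar>\<Sum>j\<in>J. t / n - x j\<bar>"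
      using J by (simp add: sum_subtractf n_def)
    also have "\<dots> \<le> (\<Sum>j\<in>J. \<bar>t / n - x j\<bar>)" by (rule sum_abs)
    also have "\<dots> < (\<Sum>j\<in>J. e / n)"
      using x J by (intro sum_strict_mono) (auto simp: PiE_iff dist_real_def n_def)
    also have "\<dots> = e" using J by (simp add: n_def)
    finally show "x \<in> (\<lambda>x. \<Sum>j\<in>J. x j) -` ball t e \<inter> space (PiM J expo)"
      using x by (auto simp: dist_real_def space_PiM PiE_iff)
  qed
  have "0 < (\<Prod>j\<in>J. emeasure (expo j) (ball (t / n) (e / n)))"
    using assms J emeasure_expo_ball_pos[of "t / n" "e / n"] by (simp add: prod_zero_iff zero_less_iff_neq_zero)
  also have "\<dots> = emeasure (PiM J expo) ?B"
    using J by (intro expo.emeasure_PiM[symmetric]) auto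
  also have "\<dots> \<le> emeasure (PiM J expo) ((\<lambda>x. \<Sum>j\<in>J. x j) -` ball t e \<inter> space (PiM J expo))"
    by (intro emeasure_mono sub measurable_sets[where A=borel]) measurable
  also have "\<dots> = emeasure (T_law m) (ball t e)"
    unfolding T_law_eq J_def by (subst emeasure_distr) auto
  finally show ?thesis .
qed

section \<open>Absolute continuity\<close>

lemma prod_nat_div_Suc_telescope: "m \<ge> 1 \<Longrightarrow> (\<Prod>j\<in>{1..m-1}. real j / (real j + 1)) = 1 / real m" for m :: nat
proof (induction m rule: dec_induct)
  case (step n)
  then have "{1..Suc n - 1} = insert n {1..n-1}" by auto
  then show ?case using step by (auto simp: field_simps)
qed simp

lemma nn_integral_indicator_singleton:
  fixes f :: "'a \<Rightarrow> 'b::t2_space"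
  assumes [measurable]: "f \<in> borel_measurable M"
  shows "(\<integral>\<^sup>+z. indicator {c} (f z) \<partial>M) = emeasure M {z \<in> space M. f z = c}"
proof -
  have "f -` {c} \<inter> space M \<in> sets M" by measurable
  then have "{z \<in> space M. f z = c} \<in> sets M" by (simp add: vimage_def Int_def conj_commute)
  then have "emeasure M {z \<in> space M. f z = c} = (\<integral>\<^sup>+z. indicator {z \<in> space M. f z = c} z \<partial>M)"
    by (rule nn_integral_indicator[symmetric])
  also have "\<dots> = (\<integral>\<^sup>+z. indicator {c} (f z) \<partial>M)"
    by (intro nn_integral_cong) (auto simp: indicator_def)
  finally show ?thesis by simp
qed

section \<open>Probability laws on the plane fixed by the smoothing equation\<close>

locale smoothing_law = prob_space \<mu> for \<mu> :: "complex measure" +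
  fixes lam :: complex and m :: nat
  assumes sets_eq_borel [measurable_cong, simp]: "sets \<mu> = sets borel"
    and m: "m \<ge> 2" and lam: "lam \<noteq> 1" "Re lam > 0"
    and fixpoint: "\<mu> = fixpoint_rhs_law lam m \<mu>"
    and integrable: "integrable \<mu> (\<lambda>z. z)"
    and mean: "(\<integral>z. z \<partial>\<mu>) \<noteq> 0"
begin

abbreviation copies :: "nat set \<Rightarrow> (nat \<Rightarrow> complex) measure" where
  "copies I \<equiv> PiM I (\<lambda>_. \<mu>)"

lemma space_eq_UNIV [simp]: "space \<mu> = UNIV"
  using sets_eq_imp_space_eq[OF sets_eq_borel] by simp

sublocale copies: product_prob_space "\<lambda>_::nat. \<mu>" UNIV
  by (simp add: product_prob_space_def product_prob_space_axioms_def product_sigma_finite_def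
      prob_space_axioms prob_space_imp_sigma_finite)

sublocale T: prob_space "T_law m" by (rule prob_space_T_law)

sublocale T_copies: pair_prob_space "T_law m" "copies I" for I
  by (simp add: pair_prob_space_def pair_sigma_finite_def prob_space_T_law prob_space_PiM
     prob_space_axioms prob_space_imp_sigma_finite)

abbreviation (input) "step t s \<equiv> exp (- (lam * complex_of_real t)) * s"

lemma step_measurable [measurable (raw)]:
  assumes [measurable]: "f \<in> borel_measurable M" "g \<in> borel_measurable M"
  shows "(\<lambda>x. step (f x) (g x)) \<in> borel_measurable M"
  by measurable

text \<open>The integral over \<open>T\<close> is innermost: with the copies held fixed,
  almost-everywhere statements in time apply to it.\<close>

lemma nn_integral_step:
  assumes [measurable]: "g \<in> borel_measurable borel"
  shows "(\<integral>\<^sup>+z. g z \<partial>\<mu>)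
    = (\<integral>\<^sup>+z. \<integral>\<^sup>+t. g (step t (\<Sum>j\<in>{1..m}. z j)) \<partial>T_law m \<partial>copies {1..m})"
proof -
  have "(\<integral>\<^sup>+z. g z \<partial>\<mu>) = (\<integral>\<^sup>+z. g z \<partial>fixpoint_rhs_law lam m \<mu>)"
    by (rule arg_cong[OF fixpoint])
  also have "\<dots> = (\<integral>\<^sup>+(t, z). g (step t (\<Sum>j\<in>{1..m}. z j)) \<partial>(T_law m \<Otimes>\<^sub>M copies {1..m}))"
    unfolding fixpoint_rhs_law_def by (subst nn_integral_distr) (auto simp: split_beta')
  also have "\<dots> = (\<integral>\<^sup>+z. \<integral>\<^sup>+t. g (step t (\<Sum>j\<in>{1..m}. z j)) \<partial>T_law m \<partial>copies {1..m})"
    by (subst T_copies.nn_integral_snd[symmetric]) auto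
  finally show ?thesis .
qed

text \<open>Here the copies are integrated innermost: at a fixed time their sum has an explicit
  mean, and a character of it factors.\<close>

lemma
  fixes g :: "complex \<Rightarrow> complex"
  assumes g: "integrable \<mu> g"
  shows integrable_step:
      "integrable (T_law m \<Otimes>\<^sub>M copies {1..m}) (\<lambda>(t, z). g (step t (\<Sum>j\<in>{1..m}. z j)))" (is ?thesis1)
    and integral_step:
      "(\<integral>z. g z \<partial>\<mu>) = (\<integral>t. \<integral>z. g (step t (\<Sum>j\<in>{1..m}. z j)) \<partial>copies {1..m} \<partial>T_law m)" (is ?thesis2)
proof -
  have [measurable]: "g \<in> borel_measurable borel" using g by auto
  have "integrable (fixpoint_rhs_law lam m \<mu>) g" using g fixpoint by simp
  then show ?thesis1
    unfolding fixpoint_rhs_law_def by (subst (asm) integrable_distr_eq) (auto simp: split_beta')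
  have "(\<integral>z. g z \<partial>\<mu>) = (\<integral>z. g z \<partial>fixpoint_rhs_law lam m \<mu>)"
    by (rule arg_cong[OF fixpoint])
  also have "\<dots> = (\<integral>(t, z). g (step t (\<Sum>j\<in>{1..m}. z j)) \<partial>(T_law m \<Otimes>\<^sub>M copies {1..m}))"
    unfolding fixpoint_rhs_law_def by (subst integral_distr) (auto simp: split_beta')
  also have "\<dots> = (\<integral>t. \<integral>z. g (step t (\<Sum>j\<in>{1..m}. z j)) \<partial>copies {1..m} \<partial>T_law m)"
    using T_copies.integral_fst'[OF \<open>?thesis1\<close>] by simp
  finally show ?thesis2 .
qed

lemma integral_sum_copies: "(\<integral>z. (\<Sum>j\<in>{1..m}. z j) \<partial>copies {1..m}) = of_nat m * (\<integral>z. z \<partial>\<mu>)"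
proof -
  have *: "distr (copies {1..m}) \<mu> (\<lambda>z. z j) = \<mu>" if "j \<in> {1..m}" for j
    using that by (intro distr_PiM_component prob_space_axioms) auto
  have "integrable (copies {1..m}) (\<lambda>z. z j) \<and> (\<integral>z. z j \<partial>copies {1..m}) = (\<integral>z. z \<partial>\<mu>)"
    if j: "j \<in> {1..m}" for j
  proof
    have meas: "(\<lambda>z. z j) \<in> copies {1..m} \<rightarrow>\<^sub>M \<mu>" using j by measurable
    have "integrable (distr (copies {1..m}) \<mu> (\<lambda>z. z j)) (\<lambda>z. z)" using * j integrable by simp
    then show "integrable (copies {1..m}) (\<lambda>z. z j)"
      by (subst (asm) integrable_distr_eq) (use meas in auto)
    have "(\<integral>z. z \<partial>distr (copies {1..m}) \<mu> (\<lambda>z. z j)) = (\<integral>z. z j \<partial>copies {1..m})"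
      by (subst integral_distr) (use meas in auto)
    then show "(\<integral>z. z j \<partial>copies {1..m}) = (\<integral>z. z \<partial>\<mu>)" using * j by simp
  qed
  then show ?thesis by simp
qed

lemma Im_lam: "Im lam \<noteq> 0"
proof
  assume "Im lam = 0"
  then have "lam = of_real (Re lam)" by (simp add: complex_eq_iff)
  then obtain r where r: "lam = of_real r" by blast
  have "r > 0" "r \<noteq> 1" using lam r by auto
  define p where "p s = (\<Prod>j\<in>{1..m-1}. real j / (real j + s))" for s
  have "(\<integral>z. z \<partial>\<mu>) = (\<integral>t. \<integral>z. step t (\<Sum>j\<in>{1..m}. z j) \<partial>copies {1..m} \<partial>T_law m)"
    by (rule integral_step[OF integrable])
  also have "\<dots> = (\<integral>t. of_real (exp (- (r * t))) * (of_nat m * (\<integral>z. z \<partial>\<mu>)) \<partial>T_law m)"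
    by (simp add: integral_sum_copies[simplified] r exp_of_real flip: of_real_mult of_real_minus)
  also have "\<dots> = of_real (\<integral>t. exp (- (r * t)) \<partial>T_law m) * (of_nat m * (\<integral>z. z \<partial>\<mu>))"
    by simp
  also have "(\<integral>t. exp (- (r * t)) \<partial>T_law m) = p r"
  proof (subst integral_eq_nn_integral)
    have "p r \<ge> 0" unfolding p_def using \<open>r > 0\<close> by (intro prod_nonneg) auto
    moreover have "(\<integral>\<^sup>+t. ennreal (exp (- (r * t))) \<partial>T_law m) = ennreal (p r)"
      unfolding p_def using \<open>r > 0\<close> by (intro nn_integral_T_law_exp) simp
    ultimately show "enn2real (\<integral>\<^sup>+t. ennreal (exp (- (r * t))) \<partial>T_law m) = p r" by simp
  qed auto
  finally have "of_real (p r * real m) = (1 :: complex)"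
    using mean by simp
  then have "p r * real m = 1" by (simp only: of_real_eq_1_iff)
  moreover have "p 1 * real m = 1" using m prod_nat_div_Suc_telescope[of m] by (simp add: p_def)
  ultimately have "p r = p 1" using m by (metis mult_cancel_right zero_neq_one mult_zero_right)
  \<comment> \<open>A nonempty product of strictly decreasing positive factors is strictly
    decreasing, so \<open>p\<close> takes the value \<open>1 / m\<close> only at 1.\<close>
  have ne: "{1..m-1} \<noteq> {}" using m by auto
  have "p a < p b" if "0 < b" "b < a" for a b
  proof -
    have "real j / (real j + a) < real j / (real j + b)" if "1 \<le> j" for j
      using that \<open>0 < b\<close> \<open>b < a\<close> by (intro divide_strict_left_mono) auto
    then show ?thesis unfolding p_def using that ne
      by (intro prod_mono_strict) (auto intro: less_imp_le)
  qed
  from this[of r 1] this[of 1 r] show False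
    using \<open>p r = p 1\<close> \<open>r > 0\<close> \<open>r \<noteq> 1\<close> by (auto simp: neq_iff)
qed

section \<open>Absence of atoms\<close>

lemma AE_T: "AE t in lborel. Q t \<Longrightarrow> AE t in T_law m. Q t"
  by (rule absolutely_continuous_AE[OF _ absolutely_continuous_T_law[OF m]]) auto

text \<open>For a fixed nonzero \<open>s\<close> the modulus of \<open>step t s\<close> is strictly
  decreasing in \<open>t\<close>, so the spiral meets \<open>c\<close> at most once; for
  \<open>s = 0\<close> it never does. Since \<open>T\<close> charges no single time, the conditional
  probability of hitting \<open>c\<close> is zero.\<close>

lemma emeasure_singleton:
  assumes "c \<noteq> 0"
  shows "emeasure \<mu> {c} = 0"
proof -
  have "AE t in T_law m. step t s \<noteq> c" for s
  proof (rule AE_T)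
    have "\<exists>a. \<forall>t. step t s = c \<longrightarrow> t = a"
    proof (cases "s = 0")
      case False
      have "t = ln (norm s / norm c) / Re lam" if "step t s = c" for t
      proof -
        have "norm c = exp (- (Re lam * t)) * norm s"
          by (subst that[symmetric]) (simp add: norm_mult)
        then have "norm s / norm c = exp (Re lam * t)" using False assms by (simp add: exp_minus field_simps)
        then show ?thesis using lam by simp
      qed
      then show ?thesis by blast
    qed (use assms in auto)
    then obtain a where "\<And>t. step t s = c \<Longrightarrow> t = a" by blast
    moreover have "AE t in lborel. t \<noteq> a" by (rule AE_lborel_singleton)
    ultimately show "AE t in lborel. step t s \<noteq> c" by (auto elim: eventually_mono)
  qed
  then have *: "(\<integral>\<^sup>+t. indicator {c} (step t s) \<partial>T_law m) = 0" for s
    by (subst nn_integral_0_iff_AE) (auto simp: indicator_def)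
  have "emeasure \<mu> {c} = (\<integral>\<^sup>+z. indicator {c} z \<partial>\<mu>)" by simp
  also have "\<dots> = 0" by (subst nn_integral_step) (auto simp: *)
  finally show ?thesis .
qed

text \<open>Conditioning on the new summand \<open>y\<close>, the induction hypothesis at
  \<open>c - y\<close> leaves only \<open>y = c\<close>. The factor
  \<open>emeasure \<mu> {c}\<close> that appears vanishes unless \<open>c = 0\<close>.\<close>

lemma emeasure_sum_copies:
  assumes "finite I"
  shows "emeasure (copies I) {z \<in> space (copies I). (\<Sum>j\<in>I. z j) = c}
    = (if c = 0 then emeasure \<mu> {0} ^ card I else 0)"
  using assms
proof (induction I arbitrary: c)
  case empty
  then show ?case
    by (auto simp: copies.emeasure_PiM[of "{}" "\<lambda>_. UNIV", simplified] PiM_empty)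
next
  case (insert i I)
  have "emeasure (copies (insert i I)) {z \<in> space (copies (insert i I)). (\<Sum>j\<in>insert i I. z j) = c}
      = (\<integral>\<^sup>+z. indicator {c} (\<Sum>j\<in>insert i I. z j) \<partial>copies (insert i I))"
    by (rule nn_integral_indicator_singleton[symmetric]) measurable
  also have "\<dots> = (\<integral>\<^sup>+y. \<integral>\<^sup>+z. indicator {c} (\<Sum>j\<in>insert i I. (z(i := y)) j) \<partial>copies I \<partial>\<mu>)"
    using insert by (intro copies.product_nn_integral_insert_rev) auto
  also have "\<dots> = (\<integral>\<^sup>+y. \<integral>\<^sup>+z. indicator {z \<in> space (copies I). (\<Sum>j\<in>I. z j) = c - y} z \<partial>copies I \<partial>\<mu>)"
  proof (intro nn_integral_cong)
    fix y and z :: "nat \<Rightarrow> complex" assume "z \<in> space (copies I)"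
    moreover have "(\<Sum>j\<in>insert i I. (z(i := y)) j) = y + (\<Sum>j\<in>I. z j)"
      using insert by (subst sum.insert) (auto intro!: sum.cong)
    ultimately show "indicator {c} (\<Sum>j\<in>insert i I. (z(i := y)) j)
      = (indicator {z \<in> space (copies I). (\<Sum>j\<in>I. z j) = c - y} z :: ennreal)"
      by (auto simp: indicator_def algebra_simps)
  qed
  also have "\<dots> = (\<integral>\<^sup>+y. emeasure \<mu> {0} ^ card I * indicator {c} y \<partial>\<mu>)"
    using insert.hyps by (intro nn_integral_cong) (subst nn_integral_indicator, auto simp: insert.IH)
  also have "\<dots> = emeasure \<mu> {0} ^ card I * emeasure \<mu> {c}"
    by (subst nn_integral_cmult_indicator) auto
  finally show ?case
    using insert.hyps by (auto simp: emeasure_singleton mult.commute)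
qed

lemma emeasure_0: "emeasure \<mu> {0} = 0"
proof -
  define q where "q = emeasure \<mu> {0}"
  have "q = (\<integral>\<^sup>+z. indicator {0} z \<partial>\<mu>)" by (simp add: q_def)
  \<comment> \<open>The exponential factor never vanishes, so one step is zero exactly when the sum
    of the copies is.\<close>
  also have "\<dots> = (\<integral>\<^sup>+z. indicator {0} (\<Sum>j\<in>{1..m}. z j) \<partial>copies {1..m})"
    by (subst nn_integral_step)
       (auto intro!: nn_integral_cong simp: indicator_def T.emeasure_space_1[simplified])
  also have "\<dots> = q ^ m"
    using emeasure_sum_copies[of "{1..m}" 0] by (subst nn_integral_indicator_singleton) (auto simp: q_def)
  finally have q: "q = q ^ m" .
  define p where "p = prob {0}"
  have "q = ennreal p" by (simp add: q_def p_def emeasure_eq_measure)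
  with q have p: "p = p ^ m" by (simp add: p_def ennreal_power)
  have "p \<noteq> 1"
  proof
    assume "p = 1"
    then have "AE z in \<mu>. z \<in> {0}" unfolding p_def by (subst (asm) prob_eq_1) auto
    then have "(\<integral>z. z \<partial>\<mu>) = (\<integral>z. 0 \<partial>\<mu>)" by (intro integral_cong_AE) auto
    then show False using mean by simp
  qed
  moreover have "p \<le> 1" by (simp add: p_def)
  ultimately have "p < 1" by simp
  moreover have "p \<ge> 0" by (simp add: p_def)
  moreover have "p ^ m \<le> p ^ 2" using \<open>p < 1\<close> \<open>p \<ge> 0\<close> m by (intro power_decreasing) auto
  ultimately have "p * (1 - p) \<le> 0" using p by (simp add: power2_eq_square algebra_simps)
  then have "p = 0" using \<open>p < 1\<close> \<open>p \<ge> 0\<close> by (simp add: mult_le_0_iff)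
  then show ?thesis using \<open>q = ennreal p\<close> by (simp add: q_def)
qed

lemma AE_sum_copies_neq_0:
  assumes "finite I" "I \<noteq> {}"
  shows "AE z in copies I. (\<Sum>j\<in>I. z j) \<noteq> 0"
proof (rule AE_I[where N = "{z \<in> space (copies I). (\<Sum>j\<in>I. z j) = 0}"])
  show "emeasure (copies I) {z \<in> space (copies I). (\<Sum>j\<in>I. z j) = 0} = 0"
    using assms by (simp add: emeasure_sum_copies emeasure_0 card_gt_0_iff)
qed auto

theorem absolutely_continuous: "absolutely_continuous lborel \<mu>"
  unfolding absolutely_continuous_def
proof
  fix N :: "complex set" assume N: "N \<in> null_sets lborel"
  then have [measurable]: "N \<in> sets borel" by auto
  define I where "I = {2..m}"
  have I: "{1..m} = insert 1 I" "finite I" "1 \<notin> I" "I \<noteq> {}" using m by (auto simp: I_def)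
  \<comment> \<open>The probability that one step from the sum \<open>s\<close> lands in
    \<open>N\<close>.\<close>
  define g where "g s = (\<integral>\<^sup>+t. indicator N (step t s) \<partial>T_law m)" for s
  have [measurable]: "g \<in> borel_measurable borel" unfolding g_def by measurable
  have AE0: "AE t1 in T_law m. AE t in T_law m. step t (step t1 s + w) \<notin> N" if "s \<noteq> 0" "w \<noteq> 0" for s w
  proof -
    have "AE t1 in lborel. AE t in T_law m. step t (step t1 s + w) \<notin> N"
      using spiral_sum_AE_not_in_null_set[OF Im_lam that N] by eventually_elim (rule AE_T)
    then show ?thesis by (rule AE_T)
  qed
  \<comment> \<open>The second unfolding replaces a single copy \<open>y\<close> by a step from
    fresh copies, while \<open>w\<close> stands for the sum of the remaining old ones.\<close>
  have gw: "(\<integral>\<^sup>+y. g (y + w) \<partial>\<mu>) = 0" if "w \<noteq> 0" for w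
  proof -
    have "(\<integral>\<^sup>+y. g (y + w) \<partial>\<mu>)
        = (\<integral>\<^sup>+z. \<integral>\<^sup>+t. g (step t (\<Sum>j\<in>{1..m}. z j) + w) \<partial>T_law m \<partial>copies {1..m})"
      by (rule nn_integral_step) measurable
    also have "\<dots> = (\<integral>\<^sup>+z. 0 \<partial>copies {1..m})"
    proof (rule nn_integral_cong_AE)
      have "AE z in copies {1..m}. (\<Sum>j\<in>{1..m}. z j) \<noteq> 0"
        using m by (intro AE_sum_copies_neq_0) auto
      then show "AE z in copies {1..m}. (\<integral>\<^sup>+t. g (step t (\<Sum>j\<in>{1..m}. z j) + w) \<partial>T_law m) = 0"
      proof eventually_elim
        case (elim z)
        have "AE t in T_law m. g (step t (\<Sum>j\<in>{1..m}. z j) + w) = 0"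
          using AE0[OF elim that]
        proof eventually_elim
          case (elim t)
          then show ?case unfolding g_def
            by (subst nn_integral_0_iff_AE) (auto simp: indicator_def)
        qed
        then show ?case by (subst nn_integral_0_iff_AE) auto
      qed
    qed
    finally show ?thesis by simp
  qed
  have "emeasure \<mu> N = (\<integral>\<^sup>+z. indicator N z \<partial>\<mu>)" by simp
  also have "\<dots> = (\<integral>\<^sup>+z. g (\<Sum>j\<in>{1..m}. z j) \<partial>copies {1..m})"
    unfolding g_def by (rule nn_integral_step) measurable
  also have "\<dots> = (\<integral>\<^sup>+z. \<integral>\<^sup>+y. g (\<Sum>j\<in>insert 1 I. (z(1 := y)) j) \<partial>\<mu> \<partial>copies I)"
    unfolding I(1) using I by (intro copies.product_nn_integral_insert) auto
  also have "\<dots> = (\<integral>\<^sup>+z. \<integral>\<^sup>+y. g (y + (\<Sum>j\<in>I. z j)) \<partial>\<mu> \<partial>copies I)"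
    using I by (intro nn_integral_cong) (auto intro!: arg_cong[where f=g] sum.cong)
  also have "\<dots> = (\<integral>\<^sup>+z. 0 \<partial>copies I)"
    using AE_sum_copies_neq_0[OF I(2,4)] by (intro nn_integral_cong_AE) (auto simp: gw elim: eventually_mono)
  finally show "N \<in> null_sets \<mu>" by (intro null_setsI) auto
qed

end

section \<open>Support\<close>

lemma spiral_semigroup_eq_UNIV:
  fixes S :: "complex set"
  assumes lam: "Im lam \<noteq> 0" "Re lam > 0" and "closed S" and z: "z \<in> S" "z \<noteq> 0" and "0 \<in> S"
    and add: "\<And>x y. x \<in> S \<Longrightarrow> y \<in> S \<Longrightarrow> x + y \<in> S"
    and spiral: "\<And>x t. x \<in> S \<Longrightarrow> t > 0 \<Longrightarrow> exp (- (lam * of_real t)) * x \<in> S"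
  shows "S = UNIV"
proof (intro set_eqI iffI UNIV_I)
  fix w :: complex
  have mult: "of_nat n * x \<in> S" if "x \<in> S" for n x
    by (induction n) (use that add \<open>0 \<in> S\<close> in \<open>auto simp: algebra_simps\<close>)
  show "w \<in> S"
  proof (cases "w = 0")
    case False
    have "\<exists>y\<in>S. dist y w < e" if "e > 0" for e
    proof -
      define c where "c = Ln (w / z)"
      have c: "exp c * z = w" using z False by (simp add: c_def)
      \<comment> \<open>Beyond time \<open>B\<close> the spiral point is within \<open>e\<close> of
        the origin; \<open>n\<close> is taken large enough that \<open>t\<close> exceeds
        \<open>B\<close>.\<close>
      define B where "B = max 0 ((ln (norm w / e) - Re c) / Re lam)"
      obtain n :: nat where n: "real n > (B * \<bar>Im lam\<bar> + \<bar>Im c\<bar>) / (2 * pi)"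
        using reals_Archimedean2 by blast
      \<comment> \<open>At this time the rotation equals the argument of \<open>w / z\<close> up to
        whole turns, so the spiral through \<open>z\<close> crosses the ray of \<open>w\<close>. The
        sign of \<open>Im lam\<close> decides the direction of turning, and the crossing point is
        \<open>exp A * w\<close>.\<close>
      define t where "t = (2 * pi * real n - sgn (Im lam) * Im c) / \<bar>Im lam\<bar>"
      have "B * \<bar>Im lam\<bar> + \<bar>Im c\<bar> < 2 * pi * real n"
        using n by (simp add: field_simps)
      moreover have "sgn (Im lam) * Im c \<le> \<bar>Im c\<bar>" by (auto simp: sgn_if)
      ultimately have "B < t" using lam by (simp add: t_def field_simps)
      then have t: "t > 0" "(ln (norm w / e) - Re c) / Re lam < t" by (auto simp: B_def)
      have "Im lam * t = sgn (Im lam) * (2 * pi * real n) - Im c"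
        using lam by (simp add: t_def sgn_if field_simps)
      define A where "A = - (Re lam * t) - Re c"
      have "- (lam * of_real t) = of_real A + (c - sgn (Im lam) * (2 * pi * real n) * \<i>)"
        using \<open>Im lam * t = _\<close> by (simp add: complex_eq_iff A_def)
      then have "exp (- (lam * of_real t)) = of_real (exp A)
          * (exp c * exp (- (sgn (Im lam) * (2 * pi * real n) * \<i>)))"
        by (simp only: exp_add exp_of_real[symmetric] diff_conv_add_uminus)
      also have "exp (- (sgn (Im lam) * (2 * pi * real n) * \<i>)) = (1 :: complex)"
      proof -
        have "exp (- (sgn (Im lam) * (2 * pi * real n) * \<i>)) = cis (2 * pi * of_int (- sgn (\<lfloor>sgn (Im lam)\<rfloor>) * int n))"
          using lam by (simp add: cis_conv_exp sgn_if mult_ac)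
        also have "\<dots> = 1" by (rule cis_multiple_2pi) simp
        finally show ?thesis .
      qed
      finally have sp: "exp (- (lam * of_real t)) * z = of_real (exp A) * w"
        using c by (simp add: mult_ac)
      define r where "r = exp A"
      have "r > 0" by (simp add: r_def)
      have "ln (norm w / e) - Re c < Re lam * t" using t(2) lam by (simp add: field_simps)
      then have "A < ln (e / norm w)"
        unfolding A_def using False \<open>e > 0\<close> by (simp add: ln_div)
      then have "r < e / norm w" using False \<open>e > 0\<close> unfolding r_def
        by (subst (asm) exp_less_cancel_iff[symmetric]) simp
      then have rw: "r * norm w < e" using False by (simp add: field_simps)
      \<comment> \<open>Rounding \<open>1 / r\<close> down leaves an error of at most
        \<open>r\<close> in \<open>N * r\<close>, hence of at most \<open>r * norm w\<close> in the
        multiple of the crossing point.\<close>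
      define N where "N = nat \<lfloor>1 / r\<rfloor>"
      have "real N \<le> 1 / r" "1 / r < real N + 1"
        using \<open>r > 0\<close> by (auto simp: N_def of_nat_nat floor_less_iff le_floor_iff)
      then have "real N * r \<le> 1" "1 < real N * r + r" using \<open>r > 0\<close> by (auto simp: field_simps)
      then have "\<bar>real N * r - 1\<bar> \<le> r" by simp
      have "of_nat N * (of_real r * w) - w = of_real (real N * r - 1) * w"
        by (simp add: algebra_simps)
      then have "dist (of_nat N * (of_real r * w)) w = \<bar>real N * r - 1\<bar> * norm w"
        by (simp add: dist_norm norm_mult del: of_real_diff of_real_mult)
      also have "\<dots> \<le> r * norm w" using \<open>\<bar>real N * r - 1\<bar> \<le> r\<close> by (rule mult_right_mono) simp
      also have "\<dots> < e" by (rule rw)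
      finally have "dist (of_nat N * (of_real r * w)) w < e" .
      moreover have "of_nat N * (of_real r * w) \<in> S"
        using mult[OF spiral[OF z(1) t(1)], of N] sp by (simp add: r_def)
      ultimately show ?thesis by blast
    qed
    then show ?thesis using \<open>closed S\<close> by (metis closed_approachable)
  qed (use \<open>0 \<in> S\<close> in simp)
qed

lemma closed_support_of:
  assumes "sets \<mu> = sets borel"
  shows "closed (support_of \<mu>)"
  unfolding closed_limpt islimpt_approachable
proof (intro allI impI)
  fix x assume x: "\<forall>e>0. \<exists>x'\<in>support_of \<mu>. x' \<noteq> x \<and> dist x' x < e"
  show "x \<in> support_of \<mu>" unfolding support_of_def
  proof (intro CollectI allI impI)
    fix e :: real assume "e > 0"
    then obtain y where y: "y \<in> support_of \<mu>" "dist y x < e" using x by blast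
    then have "0 < emeasure \<mu> (ball y (e - dist y x))" by (simp add: support_of_def)
    also have "\<dots> \<le> emeasure \<mu> (ball x e)"
    proof (rule emeasure_mono)
      show "ball y (e - dist y x) \<subseteq> ball x e"
      proof
        fix u assume "u \<in> ball y (e - dist y x)"
        then show "u \<in> ball x e" using dist_triangle[of x u y] by (simp add: dist_commute)
      qed
    qed (simp add: assms)
    finally show "emeasure \<mu> (ball x e) > 0" .
  qed
qed

context smoothing_law
begin

text \<open>By continuity, a product neighbourhood of the time and the chosen points is mapped into
  the given ball. It has positive mass because every positive time is in the support of
  \<open>T\<close>.\<close>

lemma support_step:
  assumes z: "\<And>j. j \<in> {1..m} \<Longrightarrow> z j \<in> support_of \<mu>" and t: "t > 0"
  shows "step t (\<Sum>j\<in>{1..m}. z j) \<in> support_of \<mu>"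
  unfolding support_of_def
proof (intro CollectI allI impI)
  fix e :: real assume "e > 0"
  define J where "J = {1..m}"
  define s where "s = (\<Sum>j\<in>J. z j)"
  have J: "finite J" "J \<noteq> {}" "card J = m" using m by (auto simp: J_def)
  have "continuous_on UNIV (\<lambda>p. step (fst p) (snd p))" by (intro continuous_intros)
  then have "continuous (at (t, s)) (\<lambda>p. step (fst p) (snd p))"
    by (simp add: continuous_on_eq_continuous_at)
  then obtain d where d: "d > 0" "\<And>p. dist p (t, s) < d \<Longrightarrow> dist (step (fst p) (snd p)) (step t s) < e"
    using \<open>e > 0\<close> unfolding continuous_at_eps_delta by fastforce
  \<comment> \<open>Half of \<open>d\<close> is left for the time; the other half is shared equally
    by the \<open>m\<close> summands.\<close>
  define B where "B = Pi\<^sub>E J (\<lambda>j. ball (z j) (d / 2 / real m))"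
  have B: "B \<in> sets (copies J)" unfolding B_def using J by (intro sets_PiM_I_finite) auto
  have near: "step t' (\<Sum>j\<in>J. z' j) \<in> ball (step t s) e" if "z' \<in> B" "t' \<in> ball t (d / 2)" for z' t'
  proof -
    have "dist s (\<Sum>j\<in>J. z' j) = norm (\<Sum>j\<in>J. z j - z' j)"
      by (simp add: s_def dist_norm sum_subtractf)
    also have "\<dots> \<le> (\<Sum>j\<in>J. norm (z j - z' j))" by (rule norm_sum)
    also have "\<dots> < (\<Sum>j\<in>J. d / 2 / real m)"
      using that(1) J by (intro sum_strict_mono) (auto simp: B_def PiE_iff dist_norm)
    also have "\<dots> = d / 2" using J m by simp
    finally have "dist (\<Sum>j\<in>J. z' j) s < d / 2" by (simp add: dist_commute)
    moreover have "dist t' t < d / 2" using that(2) by (simp add: dist_commute)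
    moreover have "dist (t', \<Sum>j\<in>J. z' j) (t, s) \<le> dist t' t + dist (\<Sum>j\<in>J. z' j) s"
      unfolding dist_Pair_Pair by (rule real_sqrt_sum_squares_triangle_ineq[of "dist t' t" 0 0 "dist (\<Sum>j\<in>J. z' j) s", simplified])
    ultimately have "dist (t', \<Sum>j\<in>J. z' j) (t, s) < d" by simp
    from d(2)[OF this] show ?thesis by (simp add: dist_commute)
  qed
  have "0 < (\<Prod>j\<in>J. emeasure \<mu> (ball (z j) (d / 2 / real m)))"
    using z d(1) m J by (auto simp: support_of_def J_def zero_less_iff_neq_zero prod_zero_iff)
  also have "\<dots> = emeasure (copies J) B"
    unfolding B_def using J by (intro copies.emeasure_PiM[symmetric]) auto
  finally have "0 < emeasure (T_law m) (ball t (d / 2)) * emeasure (copies J) B"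
    using emeasure_T_law_ball_pos[OF m t, of "d / 2"] d(1) by (simp add: ennreal_zero_less_mult_iff)
  also have "\<dots> = (\<integral>\<^sup>+z'. \<integral>\<^sup>+t'. indicator B z' * indicator (ball t (d / 2)) t' \<partial>T_law m \<partial>copies J)"
    using B by (subst nn_integral_cmult_indicator) (auto simp: nn_integral_multc mult.commute)
  also have "\<dots> \<le> (\<integral>\<^sup>+z'. \<integral>\<^sup>+t'. indicator (ball (step t s) e) (step t' (\<Sum>j\<in>J. z' j)) \<partial>T_law m \<partial>copies J)"
    using near by (intro nn_integral_mono) (simp add: indicator_def)
  also have "\<dots> = (\<integral>\<^sup>+x. indicator (ball (step t s) e) x \<partial>\<mu>)"
    unfolding J_def by (rule nn_integral_step[symmetric]) (intro borel_measurable_indicator, simp)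
  also have "\<dots> = emeasure \<mu> (ball (step t s) e)" by simp
  finally show "0 < emeasure \<mu> (ball (step t (\<Sum>j\<in>{1..m}. z j)) e)" by (simp only: s_def J_def)
qed

text \<open>Otherwise null balls cover the punctured plane. By the Lindelof property countably many
  suffice, so all mass would sit at 0, which carries none.\<close>

lemma support_nonzero: "\<exists>z\<in>support_of \<mu>. z \<noteq> 0"
proof (rule ccontr)
  assume no: "\<not> (\<exists>z\<in>support_of \<mu>. z \<noteq> 0)"
  define F where "F = {ball z e | z e. emeasure \<mu> (ball z e) = 0}"
  have "\<And>U. U \<in> F \<Longrightarrow> open U" by (auto simp: F_def)
  then obtain F' where F': "F' \<subseteq> F" "countable F'" "\<Union>F' = \<Union>F" using Lindelof[of F] by metis
  have "\<Union>F' \<in> null_sets \<mu>"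
    using F'(1,2) by (intro null_sets_UN'[of F' "\<lambda>x. x", simplified]) (auto simp: F_def intro!: null_setsI)
  moreover have "{0} \<in> null_sets \<mu>" using emeasure_0 by (intro null_setsI) auto
  ultimately have "\<Union>F' \<union> {0} \<in> null_sets \<mu>" by (rule null_sets.Un)
  moreover have "\<Union>F' \<union> {0} = UNIV"
  proof -
    have "z \<in> \<Union>F" if "z \<noteq> 0" for z
    proof -
      from that no have "z \<notin> support_of \<mu>" by blast
      then obtain e where "e > 0" "emeasure \<mu> (ball z e) = 0"
        by (auto simp: support_of_def not_gr_zero)
      then show ?thesis unfolding F_def by (intro UnionI[of "ball z e"]) auto
    qed
    then show ?thesis using F'(3) by blast
  qed
  ultimately show False using emeasure_space_1 by auto
qed

theorem support_eq_UNIV: "support_of \<mu> = UNIV"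
proof -
  let ?S = "support_of \<mu>"
  obtain z where z: "z \<in> ?S" "z \<noteq> 0" using support_nonzero by blast
  have cl: "closed ?S" by (rule closed_support_of) simp
  have lim: "x \<in> ?S" if "(f \<longlongrightarrow> x) G" "G \<noteq> bot" "\<forall>\<^sub>F t in G. f t \<in> ?S" for f :: "real \<Rightarrow> complex" and G x
    using Lim_in_closed_set[OF cl that(3,2,1)] .
  \<comment> \<open>Steps from copies of one support point contract to 0 as time grows, and the
    support is closed.\<close>
  have "0 \<in> ?S"
  proof (rule lim)
    show "((\<lambda>t. step t (\<Sum>j\<in>{1..m}. z)) \<longlongrightarrow> 0) at_top"
    proof (rule tendsto_norm_zero_cancel)
      have "((\<lambda>t. exp (- (Re lam * t))) \<longlongrightarrow> 0) at_top"
        using lam by real_asymp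
      then have "((\<lambda>t. exp (- (Re lam * t)) * norm (\<Sum>j\<in>{1..m}. z)) \<longlongrightarrow> 0 * norm (\<Sum>j\<in>{1..m}. z)) at_top"
        by (intro tendsto_intros)
      then show "((\<lambda>t. norm (step t (\<Sum>j\<in>{1..m}. z))) \<longlongrightarrow> 0) at_top"
        by (simp add: norm_mult)
    qed
    show "\<forall>\<^sub>F t in at_top. step t (\<Sum>j\<in>{1..m}. z) \<in> ?S"
      using eventually_gt_at_top[of 0] by eventually_elim (rule support_step, rule z)
  qed simp
  have two: "step t (x + y) \<in> ?S" if "x \<in> ?S" "y \<in> ?S" "t > 0" for x y t
  proof -
    \<comment> \<open>Since 0 is in the support, padding with zeros reduces \<open>m\<close>
      summands to two.\<close>
    let ?z = "\<lambda>j::nat. if j = 1 then x else if j = 2 then y else 0"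
    have "(\<Sum>j\<in>{1..m}. ?z j) = (\<Sum>j\<in>{1, 2}. ?z j)"
      using m by (intro sum.mono_neutral_right) auto
    also have "\<dots> = x + y" by simp
    finally have "(\<Sum>j\<in>{1..m}. ?z j) = x + y" .
    moreover have "step t (\<Sum>j\<in>{1..m}. ?z j) \<in> ?S"
      using that \<open>0 \<in> ?S\<close> by (intro support_step) auto
    ultimately show ?thesis by simp
  qed
  show ?thesis
  proof (rule spiral_semigroup_eq_UNIV[OF Im_lam lam(2) cl z \<open>0 \<in> ?S\<close>])
    \<comment> \<open>Letting time tend to 0 from the right removes the exponential factor.\<close>
    show "x + y \<in> ?S" if "x \<in> ?S" "y \<in> ?S" for x y
    proof (rule lim)
      have "continuous_on UNIV (\<lambda>t. step t (x + y))" by (intro continuous_intros)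
      then have "isCont (\<lambda>t. step t (x + y)) 0" by (simp add: continuous_on_eq_continuous_at)
      then show "((\<lambda>t. step t (x + y)) \<longlongrightarrow> x + y) (at_right 0)"
        by (auto simp: isCont_def intro: tendsto_within_subset)
      show "\<forall>\<^sub>F t in at_right 0. step t (x + y) \<in> ?S"
        using two[OF that] by (simp add: eventually_at_right_less eventually_mono[OF eventually_at_right_less])
    qed simp
    show "step t x \<in> ?S" if "x \<in> ?S" "t > 0" for x t
      using two[OF that(1) \<open>0 \<in> ?S\<close> that(2)] by simp
  qed
qed

section \<open>Fourier decay\<close>

definition char_fun :: "complex \<Rightarrow> complex" where
  "char_fun t = (\<integral>z. cis (cinner t z) \<partial>\<mu>)"

lemma integrable_cis_cinner: "integrable \<mu> (\<lambda>z. cis (cinner t z))"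
  by (rule integrable_const_bound[where B=1]) auto

lemma norm_char_fun_le_1: "norm (char_fun t) \<le> 1"
proof -
  have "norm (char_fun t) \<le> (\<integral>z. norm (cis (cinner t z)) \<partial>\<mu>)"
    unfolding char_fun_def by (rule integral_norm_bound)
  then show ?thesis by (simp add: prob_space[simplified])
qed

lemma char_fun_tendsto_0: "(char_fun \<longlongrightarrow> 0) at_infinity"
proof -
  \<comment> \<open>The Radon-Nikodym derivative has total integral 1, hence is finite almost
    everywhere; truncating infinity to 0 does not change the law.\<close>
  define f where "f z = enn2real (RN_deriv lborel \<mu> z)" for z
  have [measurable]: "f \<in> borel_measurable borel"
    unfolding f_def using borel_measurable_RN_deriv[of lborel \<mu>] by simp
  have RN: "density lborel (RN_deriv lborel \<mu>) = \<mu>"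
    by (intro sigma_finite_measure.density_RN_deriv[OF sigma_finite_lborel] absolutely_continuous) simp
  have "emeasure (density lborel (RN_deriv lborel \<mu>)) UNIV = 1"
    unfolding RN using emeasure_space_1 by simp
  then have one: "(\<integral>\<^sup>+z. RN_deriv lborel \<mu> z \<partial>lborel) = 1"
    by (subst (asm) emeasure_density) auto
  then have "AE z in lborel. RN_deriv lborel \<mu> z \<noteq> \<infinity>"
    by (intro nn_integral_PInf_AE) auto
  then have AE: "AE z in lborel. RN_deriv lborel \<mu> z = ennreal (f z)"
    by eventually_elim (auto simp: f_def less_top)
  have dens: "\<mu> = density lborel (\<lambda>z. ennreal (f z))"
    by (subst RN[symmetric], rule density_cong) (use AE in auto)
  have "integrable lborel f"
  proof (rule integrableI_nonneg)
    have "(\<integral>\<^sup>+z. ennreal (f z) \<partial>lborel) = 1"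
      using one nn_integral_cong_AE[OF AE] by simp
    then show "(\<integral>\<^sup>+z. ennreal (f z) \<partial>lborel) < \<infinity>" by simp
  qed (auto simp: f_def)
  then have "((\<lambda>t. \<integral>z. f z *\<^sub>R cis (cinner t z) \<partial>lborel) \<longlongrightarrow> 0) at_infinity"
    by (rule Riemann_Lebesgue)
  moreover have "char_fun = (\<lambda>t. \<integral>z. f z *\<^sub>R cis (cinner t z) \<partial>lborel)"
  proof
    fix t
    have "char_fun t = (\<integral>z. cis (cinner t z) \<partial>density lborel (\<lambda>z. ennreal (f z)))"
      unfolding char_fun_def by (rule arg_cong[OF dens])
    also have "\<dots> = (\<integral>z. f z *\<^sub>R cis (cinner t z) \<partial>lborel)"
      by (subst integral_density) (auto simp: f_def)
    finally show "char_fun t = \<dots>" .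
  qed
  ultimately show ?thesis by (simp only:)
qed

text \<open>The adjoint of multiplication by a complex number is multiplication by its conjugate, so
  the random factor moves onto the frequency. Independence of the copies then gives the power
  \<open>m\<close>.\<close>

lemma char_fun_step:
  "char_fun t = (\<integral>u. char_fun (cnj (exp (- (lam * of_real u))) * t) ^ m \<partial>T_law m)"
proof -
  have "(\<integral>z. cis (cinner t (step u (\<Sum>j\<in>{1..m}. z j))) \<partial>copies {1..m})
      = char_fun (cnj (exp (- (lam * of_real u))) * t) ^ m" for u
  proof -
    let ?t = "cnj (exp (- (lam * of_real u))) * t"
    have "cinner ?t (\<Sum>j\<in>J. z j) = (\<Sum>j\<in>J. cinner ?t (z j))" for z :: "nat \<Rightarrow> complex" and J
      unfolding cinner_def by (simp only: sum_distrib_left Re_sum)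
    moreover have "cis (\<Sum>j\<in>J. f j) = (\<Prod>j\<in>J. cis (f j))" if "finite J" for J :: "nat set" and f
      using that by induction (auto simp: cis_mult[symmetric])
    moreover have "cinner t (step u s) = cinner ?t s" for s
      by (simp add: cinner_def mult_ac)
    ultimately have "(\<integral>z. cis (cinner t (step u (\<Sum>j\<in>{1..m}. z j))) \<partial>copies {1..m})
       = (\<integral>z. (\<Prod>j\<in>{1..m}. cis (cinner ?t (z j))) \<partial>copies {1..m})"
      by (simp del: complex_cnj_mult)
    also have "\<dots> = (\<Prod>j\<in>{1..m}. char_fun ?t)"
      unfolding char_fun_def by (rule copies.product_integral_prod) (auto intro: integrable_cis_cinner)
    finally show ?thesis by simp
  qed
  then show ?thesis
    using integral_step[OF integrable_cis_cinner[of t]] by (simp add: char_fun_def)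
qed

theorem char_fun_decay:
  assumes a: "0 < a" "a < 1 / Re lam"
  shows "\<exists>C. \<forall>t. t \<noteq> 0 \<longrightarrow> norm (char_fun t) \<le> C * norm t powr (- a)"
proof -
  define b where "b = a * Re lam"
  have b: "b < 1" using a lam by (simp add: b_def field_simps)
  define K where "K = (\<integral>u. exp (b * u) \<partial>T_law m)"
  have int: "integrable (T_law m) (\<lambda>u. exp (b * u))"
  proof (rule integrableI_nonneg)
    show "(\<integral>\<^sup>+u. ennreal (exp (b * u)) \<partial>T_law m) < \<infinity>"
      using nn_integral_T_law_exp[of "- b" m] b by simp
  qed auto
  have "K \<ge> 0" unfolding K_def by simp
  \<comment> \<open>This makes \<open>\<epsilon> * K \<le> 1 / 2\<close>, so that averaging over
    \<open>T\<close> still contracts by one half although \<open>exp (b * u)\<close> grows.\<close>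
  define \<epsilon> where "\<epsilon> = 1 / (2 * (K + 1))"
  have eps: "\<epsilon> > 0" "\<epsilon> * K \<le> 1 / 2" "\<epsilon> \<le> 1 / 2"
    using \<open>K \<ge> 0\<close> by (auto simp: \<epsilon>_def field_simps)
  have "\<forall>\<^sub>F t in at_infinity. dist (char_fun t) 0 < \<epsilon>"
    using char_fun_tendsto_0 eps(1) by (rule tendstoD)
  then obtain R0 where R0: "\<And>t. norm t \<ge> R0 \<Longrightarrow> norm (char_fun t) < \<epsilon>"
    by (auto simp: eventually_at_infinity)
  define R where "R = max 1 R0"
  have R: "R > 0" "\<And>t. norm t \<ge> R \<Longrightarrow> norm (char_fun t) < \<epsilon>" using R0 by (auto simp: R_def)
  define C where "C = R powr a * K"
  have "C \<ge> 0" using \<open>K \<ge> 0\<close> by (simp add: C_def)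
  \<comment> \<open>Outside radius \<open>R\<close> one of the at least two factors is below
    \<open>\<epsilon>\<close>. Inside it the trivial bound 1 is at most
    \<open>(R / norm s) powr a\<close>.\<close>
  have powm: "norm (char_fun s) ^ m \<le> \<epsilon> * norm (char_fun s) + R powr a * norm s powr (- a)" if "s \<noteq> 0" for s
  proof (cases "norm s \<ge> R")
    case True
    have "norm (char_fun s) ^ m \<le> norm (char_fun s) ^ 2"
      using m norm_char_fun_le_1 by (intro power_decreasing) auto
    also have "\<dots> \<le> \<epsilon> * norm (char_fun s)"
      unfolding power2_eq_square using R(2)[OF True] by (intro mult_right_mono) auto
    finally show ?thesis by (simp add: add_increasing2)
  next
    case False
    have "norm (char_fun s) ^ m \<le> 1" using norm_char_fun_le_1 by (intro power_le_one) auto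
    also have "1 \<le> (R / norm s) powr a" using False a that by (intro ge_one_powr_ge_zero) auto
    also have "\<dots> = R powr a * norm s powr (- a)"
      using R(1) by (simp add: powr_divide powr_minus_divide)
    finally show ?thesis using eps(1) by (simp add: add_increasing)
  qed
  \<comment> \<open>The induction starts from the trivial bound 1. One application of the equation
    sends the coefficient \<open>2 * C\<close> to at most
    \<open>2 * (\<epsilon> * K) * C + C\<close>, which is again at most \<open>2 * C\<close>, and
    halves the additive error.\<close>
  have bound: "norm (char_fun t) \<le> 2 * C * norm t powr (- a) + (1 / 2) ^ n" if "t \<noteq> 0" for n t
    using that
  proof (induction n arbitrary: t)
    case 0
    then show ?case using norm_char_fun_le_1[of t] \<open>C \<ge> 0\<close> by (simp add: add_increasing)
  next
    case (Suc n)
    let ?s = "\<lambda>u. cnj (exp (- (lam * of_real u))) * t"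
    \<comment> \<open>The modulus of the frequency shrinks by \<open>exp (- (Re lam * u))\<close>,
      which the power \<open>- a\<close> turns into the factor \<open>exp (b * u)\<close> with
      finite mean \<open>K\<close>.\<close>
    have s: "?s u \<noteq> 0" "norm (?s u) powr (- a) = exp (b * u) * norm t powr (- a)" for u
      using Suc.prems by (auto simp: norm_mult powr_mult b_def exp_powr_real mult_ac powr_def exp_add[symmetric] ln_mult algebra_simps)
    let ?g = "\<lambda>u. (2 * \<epsilon> * C + R powr a) * norm t powr (- a) * exp (b * u) + \<epsilon> * (1 / 2) ^ n"
    have "norm (char_fun t) \<le> (\<integral>u. norm (char_fun (?s u) ^ m) \<partial>T_law m)"
      by (subst char_fun_step) (rule integral_norm_bound)
    also have "\<dots> \<le> (\<integral>u. ?g u \<partial>T_law m)"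
    proof (rule integral_mono')
      show "integrable (T_law m) ?g" using int by simp
      fix u
      have "norm (char_fun (?s u) ^ m) \<le> \<epsilon> * norm (char_fun (?s u)) + R powr a * norm (?s u) powr (- a)"
        using powm[OF s(1)] by (simp add: norm_power)
      also have "\<dots> \<le> \<epsilon> * (2 * C * norm (?s u) powr (- a) + (1 / 2) ^ n) + R powr a * norm (?s u) powr (- a)"
        using eps(1) by (intro add_right_mono mult_left_mono Suc.IH s) auto
      also have "\<dots> = ?g u" unfolding s by (simp add: algebra_simps)
      finally show "norm (char_fun (?s u) ^ m) \<le> ?g u" .
      then show "0 \<le> ?g u" using norm_ge_zero order_trans by blast
    qed
    also have "\<dots> = (2 * \<epsilon> * C + R powr a) * norm t powr (- a) * K + \<epsilon> * (1 / 2) ^ n"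
      using int by (simp add: K_def T.prob_space[simplified])
    also have "\<dots> = (2 * (\<epsilon> * K) * C + C) * norm t powr (- a) + \<epsilon> * (1 / 2) ^ n"
      by (simp add: C_def algebra_simps)
    also have "\<dots> \<le> (2 * (1 / 2) * C + C) * norm t powr (- a) + (1 / 2) * (1 / 2) ^ n"
      using eps \<open>C \<ge> 0\<close> by (intro add_mono mult_right_mono mult_left_mono) auto
    finally show ?case by simp
  qed
  have "norm (char_fun t) \<le> 2 * C * norm t powr (- a)" if "t \<noteq> 0" for t
  proof -
    have "(\<lambda>n. 2 * C * norm t powr (- a) + (1 / 2) ^ n) \<longlonglongrightarrow> 2 * C * norm t powr (- a) + 0"
      by (intro tendsto_intros LIMSEQ_power_zero) auto
    then have "norm (char_fun t) \<le> 2 * C * norm t powr (- a) + 0"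
      by (rule LIMSEQ_le_const) (use bound[OF that] in auto)
    then show ?thesis by simp
  qed
  then show ?thesis by (intro exI[of _ "2 * C"]) simp
qed

end

section \<open>Return from the law to the random variable\<close>

theorem theorem7p1:
  fixes M :: "'a measure" and Z :: "'a \<Rightarrow> complex" and lam :: complex and m :: nat
  assumes "m \<ge> 2"
    and "lam \<noteq> 1" and "Re lam > 0"
    and "prob_space M"
    and "Z \<in> borel_measurable M"
    and "distr M borel Z = fixpoint_rhs_law lam m (distr M borel Z)"
    and "integrable M Z"
    and "integral\<^sup>L M Z \<noteq> 0"
  shows "support_of (distr M borel Z) = UNIV
       \<and> (\<forall>a. 0 < a \<and> a < 1 / Re lam \<longrightarrow>
           (\<lambda>t. norm (LINT \<omega>|M. exp (\<i> * complex_of_real (cinner t (Z \<omega>)))))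
             \<in> O[at_infinity](\<lambda>t. norm t powr (- a)))
       \<and> (\<exists>f. f \<in> borel_measurable borel \<and> distr M borel Z = density lborel f)"
proof -
  have Z [measurable]: "Z \<in> borel_measurable M" by fact
  define \<mu> where "\<mu> = distr M borel Z"
  interpret smoothing_law \<mu> lam m
  proof (unfold smoothing_law_def smoothing_law_axioms_def, intro conjI)
    show "prob_space \<mu>" unfolding \<mu>_def using assms(4) Z by (rule prob_space.prob_space_distr)
    show "complex_integrable \<mu> (\<lambda>z. z)" unfolding \<mu>_def using assms(7) by (subst integrable_distr_eq) auto
    show "(\<integral>z. z \<partial>\<mu>) \<noteq> 0" unfolding \<mu>_def using assms(8) by (subst integral_distr) auto
  qed (use assms in \<open>auto simp: \<mu>_def\<close>)
  have char: "(LINT \<omega>|M. exp (\<i> * complex_of_real (cinner t (Z \<omega>)))) = char_fun t" for t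
    unfolding char_fun_def unfolding \<mu>_def by (subst integral_distr) (auto simp: cis_conv_exp)
  have "(\<lambda>t. norm (char_fun t)) \<in> O[at_infinity](\<lambda>t. norm t powr (- a))"
    if a: "0 < a \<and> a < 1 / Re lam" for a
  proof -
    from a have "\<exists>C. \<forall>t. t \<noteq> 0 \<longrightarrow> norm (char_fun t) \<le> C * norm t powr (- a)"
      by (intro char_fun_decay) simp_all
    then obtain C where C: "\<forall>t. t \<noteq> 0 \<longrightarrow> norm (char_fun t) \<le> C * norm t powr (- a)" ..
    show ?thesis
    proof (rule bigoI[of _ C])
      show "\<forall>\<^sub>F t in at_infinity. norm (norm (char_fun t)) \<le> C * norm (norm t powr (- a))"
        unfolding eventually_at_infinity
      proof (intro exI[of _ 1] allI impI)
        fix t :: complex assume "1 \<le> norm t"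
        then have "t \<noteq> 0" by auto
        with C show "norm (norm (char_fun t)) \<le> C * norm (norm t powr (- a))" by simp
      qed
    qed
  qed
  moreover have "density lborel (RN_deriv lborel \<mu>) = \<mu>"
    by (intro sigma_finite_measure.density_RN_deriv[OF sigma_finite_lborel] absolutely_continuous) simp
  then have "\<exists>f. f \<in> borel_measurable borel \<and> \<mu> = density lborel f"
    using borel_measurable_RN_deriv[of lborel \<mu>] by (intro exI[of _ "RN_deriv lborel \<mu>"]) simp
  ultimately show ?thesis
    using support_eq_UNIV by (simp add: char flip: \<mu>_def)
qed

end
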